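(* There is a polynomial-time algorithm with oracle access to a decision oracle for PCE which, on input two permutationally equivalent $[n,k,d]_q$ codes $\mathcal{C}_1,\mathcal{C}_2$ (given by generator matrices $G,F\in\mathbb{F}_q^{k\times n}$), solves search-PCE, i.e. outputs a permutation $\pi\in\mathcal{S}_n$ with $\pi(\mathcal{C}_1)=\mathcal{C}_2$ (equivalently, a permutation matrix $P$ for which there exists $S\in\mathrm{GL}_k(\mathbb{F}_q)$ with $SGP=F$). The algorithm makes at most $n^2$ calls to the PCE oracle, and each call is on a pair of codes over $\mathbb{F}_q$ of dimension $k$ and length at most $n^2(n+1)/2$.
   Context: $\mathbb{F}_q$ is the finite field with $q$ elements. An $[n,k,d]_q$ code is a $k$-dimensional $\mathbb{F}_q$-subspace of $\mathbb{F}_q^n$ whose minimum nonzero Hamming weight is $d$; $n$ is its length and $k$ its dimension. A generator matrix of such a code is a matrix in $\mathbb{F}_q^{k\times n}$ whose rows span the code. $\mathcal{S}_n$ is the group of permutations of $\{1,\dots,n\}$, acting on $\mathbb{F}_q^n$ by permuting coordinates: $\pi(x)=y$ with $y_{\pi(i)}=x_i$. PCE (Permutation Code Equivalence, decision problem): given two $[n,k,d]_q$ codes $\mathcal{C}_1,\mathcal{C}_2$ by generator matrices $G_1,G_2$, decide whether there is $\pi\in\mathcal{S}_n$ with $\mathcal{C}_2=\pi(\mathcal{C}_1)$; equivalently whether there are $S\in\mathrm{GL}_k(\mathbb{F}_q)$ and an $n\times n$ permutation matrix $P$ with $G_2=SG_1P$. Two codes for which the answer is positive are called permutationally equivalent.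 search-PCE: given two permutationally equivalent codes, find such a $\pi$. Polynomial time means polynomial in the size of the input, each oracle call counting as one step. *)

theory Defs
  imports
    "Jordan_Normal_Form.Missing_VectorSpace"
    "HOL-Combinatorics.Permutations"
    "HOL-Computational_Algebra.Polynomial"
    "HOL-Library.Log_Nat"
begin

section \<open>Linear codes and permutation equivalence\<close>

text \<open>
  Fields are records in the style of HOL-Algebra, so that one program can be quantified before the
  field. A vector of length \<open>n\<close> is a list of length \<open>n\<close>; coordinates are numbered from \<open>0\<close>.
  The fields \<open>mult\<close> and \<open>one\<close> of a module record have no meaning for a vector space.
\<close>

definition coord_space :: "('a, 'b) ring_scheme \<Rightarrow> nat \<Rightarrow> ('a, 'a list) module" where
  "coord_space F n =
    \<lparr>carrier = {v. length v = n \<and> set v \<subseteq> carrier F},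
     monoid.mult = undefined,
     one = undefined,
     zero = replicate n \<zero>\<^bsub>F\<^esub>,
     add = map2 (\<lambda>x y. x \<oplus>\<^bsub>F\<^esub> y),
     module.smult = (\<lambda>a. map (\<lambda>x. a \<otimes>\<^bsub>F\<^esub> x))\<rparr>"

definition weight :: "('a, 'b) ring_scheme \<Rightarrow> 'a list \<Rightarrow> nat" where
  "weight F v = card {i. i < length v \<and> v ! i \<noteq> \<zero>\<^bsub>F\<^esub>}"

definition linear_code :: "('a, 'b) ring_scheme \<Rightarrow> nat \<Rightarrow> nat \<Rightarrow> 'a list set \<Rightarrow> bool" where
  "linear_code F n k C \<longleftrightarrow>
     VectorSpace.subspace F C (coord_space F n) \<and>
     vectorspace.dim F ((coord_space F n)\<lparr>carrier := C\<rparr>) = k"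

definition min_weight :: "('a, 'b) ring_scheme \<Rightarrow> nat \<Rightarrow> 'a list set \<Rightarrow> nat \<Rightarrow> bool" where
  "min_weight F n C d \<longleftrightarrow>
     (\<exists>c\<in>C. c \<noteq> \<zero>\<^bsub>coord_space F n\<^esub> \<and> weight F c = d) \<and>
     (\<forall>c\<in>C. c \<noteq> \<zero>\<^bsub>coord_space F n\<^esub> \<longrightarrow> d \<le> weight F c)"

text \<open>An \<open>[n,k,d]\<close> code over \<open>F\<close>. Existence of a nonzero codeword forces \<open>k \<ge> 1\<close>.\<close>

definition code :: "('a, 'b) ring_scheme \<Rightarrow> nat \<Rightarrow> nat \<Rightarrow> nat \<Rightarrow> 'a list set \<Rightarrow> bool" where
  "code F n k d C \<longleftrightarrow> linear_code F n k C \<and> min_weight F n C d"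

text \<open>A \<open>k \<times> n\<close> matrix is the list of its rows.\<close>

definition generator_matrix ::
    "('a, 'b) ring_scheme \<Rightarrow> nat \<Rightarrow> nat \<Rightarrow> 'a list list \<Rightarrow> 'a list set \<Rightarrow> bool" where
  "generator_matrix F n k G C \<longleftrightarrow>
     length G = k \<and> set G \<subseteq> carrier (coord_space F n) \<and>
     LinearCombinations.module.span F (coord_space F n) (set G) = C"

text \<open>
  The action is \<open>\<pi>(x) = y\<close> with \<open>y ! \<pi> i = x ! i\<close>; see \<open>act_nth\<close> below.
  The inverse appears because \<open>permute_list f x\<close> has \<open>x ! f i\<close> at position \<open>i\<close>.
\<close>

definition act :: "(nat \<Rightarrow> nat) \<Rightarrow> 'a list \<Rightarrow> 'a list" where
  "act \<pi> x = permute_list (inv_into UNIV \<pi>) x"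

definition perm_equivalent :: "nat \<Rightarrow> 'a list set \<Rightarrow> 'a list set \<Rightarrow> bool" where
  "perm_equivalent n C1 C2 \<longleftrightarrow> (\<exists>\<pi>. \<pi> permutes {..<n} \<and> C2 = act \<pi> ` C1)"

lemma act_nth:
  assumes "\<pi> permutes {..<length x}" "i < length x"
  shows "act \<pi> x ! (\<pi> i) = x ! i"
proof -
  have "\<pi> i < length x"
    using permutes_in_image[OF assms(1), of i] assms(2) by simp
  then show ?thesis
    using assms permutes_inv[OF assms(1)]
    by (simp add: act_def permute_list_nth)
qed

lemma coord_space_simps [simp]:
  "carrier (coord_space F n) = {v. length v = n \<and> set v \<subseteq> carrier F}"
  "\<zero>\<^bsub>coord_space F n\<^esub> = replicate n \<zero>\<^bsub>F\<^esub>"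
  "v \<oplus>\<^bsub>coord_space F n\<^esub> w = map2 (\<lambda>x y. x \<oplus>\<^bsub>F\<^esub> y) v w"
  "a \<odot>\<^bsub>coord_space F n\<^esub> v = map (\<lambda>x. a \<otimes>\<^bsub>F\<^esub> x) v"
  by (simp_all add: coord_space_def)

lemma vectorspace_coord_space:
  assumes "field F"
  shows "vectorspace F (coord_space F n)"
proof -
  interpret field F by fact
  have carr: "v \<in> carrier (coord_space F n) \<longleftrightarrow> length v = n \<and> (\<forall>i<n. v ! i \<in> carrier F)" for v
    by (auto simp: in_set_conv_nth subset_iff)
  note [simp del] = coord_space_simps(1)
  have "Module.module F (coord_space F n)"
  proof (rule module_criteria, goal_cases)
    case 4
    show ?case
    proof
      fix v assume "v \<in> carrier (coord_space F n)"
      then show "\<exists>w\<in>carrier (coord_space F n).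
          v \<oplus>\<^bsub>coord_space F n\<^esub> w = \<zero>\<^bsub>coord_space F n\<^esub>"
        by (intro bexI[of _ "map (\<lambda>x. \<ominus>\<^bsub>F\<^esub> x) v"])
          (simp_all add: carr list_eq_iff_nth_eq r_neg)
    qed
  next
    case 6
    show ?case
      by (simp add: carr list_eq_iff_nth_eq a_comm)
  qed (simp_all add: carr list_eq_iff_nth_eq is_cring a_assoc m_assoc l_distr r_distr)
  then show ?thesis
    by (simp add: vectorspace_def assms)
qed

section \<open>Random access machines with an oracle\<close>

text \<open>
  Structured programs for a random access machine with finitely many registers (those named in the
  program), a memory \<open>M\<close> addressed by natural numbers, a write-only output tape and a write-only
  query tape:

  \<^item> \<open>Const x a\<close> is \<open>x := a\<close>; \<open>Plus x y z\<close> and \<open>Minus x y z\<close> are \<open>x := y + z\<close>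
    and \<open>x := y - z\<close> (truncated);
  \<^item> \<open>Load x y\<close> is \<open>x := M[y]\<close>; \<open>Store x y\<close> is \<open>M[x] := y\<close>;
  \<^item> \<open>Write x\<close> and \<open>Put x\<close> append the content of \<open>x\<close> to the output and the query tape;
  \<^item> \<open>Ask x\<close> submits the query tape to the oracle, stores the answer (1 or 0) in \<open>x\<close> and
    clears the query tape;
  \<^item> \<open>Branch x P Q\<close> and \<open>Loop x P\<close> test \<open>x \<noteq> 0\<close>.

  The logarithmic cost measure is used: an instruction is charged one step plus the number of bits
  it handles, and an oracle call costs one step, its query having been paid for by \<open>Put\<close>. Under
  this measure random access machines and multitape Turing machines simulate each other with
  polynomial overhead. The component \<open>asked\<close> is only a record of the queries made so far.
\<close>

datatype prog =
    Skip
  | Const nat nat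
  | Plus nat nat nat
  | Minus nat nat nat
  | Load nat nat
  | Store nat nat
  | Write nat
  | Put nat
  | Ask nat
  | Seq prog prog
  | Branch nat prog prog
  | Loop nat prog

record state =
  reg :: "nat \<Rightarrow> nat"
  mem :: "nat \<Rightarrow> nat"
  out :: "nat list"
  qtape :: "nat list"
  asked :: "nat list list"

text \<open>The number of binary digits, with \<open>bits 0 = 0\<close>.\<close>

abbreviation bits :: "nat \<Rightarrow> nat" where
  "bits \<equiv> floorlog 2"

definition set_reg :: "nat \<Rightarrow> nat \<Rightarrow> state \<Rightarrow> state" where
  "set_reg x a s = s\<lparr>reg := (reg s)(x := a)\<rparr>"

text \<open>\<open>exec Q P s t s'\<close>: with oracle \<open>Q\<close>, program \<open>P\<close> started in \<open>s\<close> halts in \<open>s'\<close> at cost \<open>t\<close>.\<close>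

inductive exec :: "(nat list \<Rightarrow> bool) \<Rightarrow> prog \<Rightarrow> state \<Rightarrow> nat \<Rightarrow> state \<Rightarrow> bool"
  for Q :: "nat list \<Rightarrow> bool" where
  Skip: "exec Q Skip s 1 s"
| Const: "exec Q (Const x a) s (1 + bits a) (set_reg x a s)"
| Plus: "exec Q (Plus x y z) s (1 + bits (reg s y) + bits (reg s z))
          (set_reg x (reg s y + reg s z) s)"
| Minus: "exec Q (Minus x y z) s (1 + bits (reg s y) + bits (reg s z))
          (set_reg x (reg s y - reg s z) s)"
| Load: "exec Q (Load x y) s (1 + bits (reg s y) + bits (mem s (reg s y)))
          (set_reg x (mem s (reg s y)) s)"
| Store: "exec Q (Store x y) s (1 + bits (reg s x) + bits (reg s y))
          (s\<lparr>mem := (mem s)(reg s x := reg s y)\<rparr>)"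
| Write: "exec Q (Write x) s (1 + bits (reg s x)) (s\<lparr>out := out s @ [reg s x]\<rparr>)"
| Put: "exec Q (Put x) s (1 + bits (reg s x)) (s\<lparr>qtape := qtape s @ [reg s x]\<rparr>)"
| Ask: "exec Q (Ask x) s 1
          ((set_reg x (of_bool (Q (qtape s))) s)\<lparr>qtape := [], asked := asked s @ [qtape s]\<rparr>)"
| Seq: "exec Q P1 s t1 s1 \<Longrightarrow> exec Q P2 s1 t2 s2 \<Longrightarrow> exec Q (Seq P1 P2) s (t1 + t2) s2"
| Branch_then: "reg s x \<noteq> 0 \<Longrightarrow> exec Q P1 s t s1 \<Longrightarrow>
     exec Q (Branch x P1 P2) s (1 + bits (reg s x) + t) s1"
| Branch_else: "reg s x = 0 \<Longrightarrow> exec Q P2 s t s1 \<Longrightarrow>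
     exec Q (Branch x P1 P2) s (1 + t) s1"
| Loop_end: "reg s x = 0 \<Longrightarrow> exec Q (Loop x P) s 1 s"
| Loop_step: "reg s x \<noteq> 0 \<Longrightarrow> exec Q P s t1 s1 \<Longrightarrow> exec Q (Loop x P) s1 t2 s2 \<Longrightarrow>
     exec Q (Loop x P) s (1 + bits (reg s x) + t1 + t2) s2"

text \<open>The machine is deterministic, so a halting execution is the only one.\<close>

inductive_cases exec_elims:
  "exec Q Skip s t s'"
  "exec Q (Const x a) s t s'"
  "exec Q (Plus x y z) s t s'"
  "exec Q (Minus x y z) s t s'"
  "exec Q (Load x y) s t s'"
  "exec Q (Store x y) s t s'"
  "exec Q (Write x) s t s'"
  "exec Q (Put x) s t s'"
  "exec Q (Ask x) s t s'"
  "exec Q (Seq P1 P2) s t s'"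
  "exec Q (Branch x P1 P2) s t s'"
  "exec Q (Loop x P) s t s'"

lemma exec_deterministic:
  "exec Q P s t s' \<Longrightarrow> exec Q P s u s'' \<Longrightarrow> u = t \<and> s'' = s'"
proof (induction arbitrary: u s'' rule: exec.induct)
  case (Seq P1 s t1 s1 P2 t2 s2)
  from Seq.prems show ?case by (rule exec_elims) (use Seq.IH in blast)
next
  case (Branch_then s x P1 t s1 P2)
  from Branch_then.prems show ?case
    by (rule exec_elims) (use Branch_then.hyps(1) in \<open>auto dest: Branch_then.IH\<close>)
next
  case (Branch_else s x P2 t s1 P1)
  from Branch_else.prems show ?case
    by (rule exec_elims) (use Branch_else.hyps(1) in \<open>auto dest: Branch_else.IH\<close>)
next
  case (Loop_end s x P)
  from Loop_end.prems show ?case by (rule exec_elims) (use Loop_end.hyps in simp_all)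
next
  case (Loop_step s x P t1 s1 t2 s2)
  from Loop_step.prems show ?case
    by (rule exec_elims) (use Loop_step.hyps(1) in \<open>auto dest!: Loop_step.IH\<close>)
qed (auto elim: exec_elims)

text \<open>The input word is placed in the memory cells \<open>0, 1, 2, \<dots>\<close>; everything else is zero or empty.\<close>

definition init :: "nat list \<Rightarrow> state" where
  "init w = \<lparr>reg = (\<lambda>_. 0), mem = (\<lambda>i. if i < length w then w ! i else 0),
     out = [], qtape = [], asked = []\<rparr>"

text \<open>The size of an input is its length in bits, plus one separator for each number.\<close>

definition input_size :: "nat list \<Rightarrow> nat" where
  "input_size w = (\<Sum>a\<leftarrow>w. 1 + bits a)"

section \<open>The decision oracle\<close>

text \<open>
  A field with \<open>q\<close> elements is represented with carrier \<open>{..<q}\<close>, so that its elements are numbers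
  the machine can handle. A pair of \<open>k \<times> n\<close> matrices is given by \<open>q\<close>, \<open>k\<close>, \<open>n\<close> and the entries of both
  matrices, row by row. Instances and queries use the same encoding.
\<close>

definition encode :: "nat \<Rightarrow> nat \<Rightarrow> nat \<Rightarrow> nat list list \<Rightarrow> nat list list \<Rightarrow> nat list" where
  "encode q k n A B = q # k # n # concat A @ concat B"

text \<open>
  The minimum weights of the two codes of an instance may differ; the answer is then negative. They
  are not part of the encoding.
\<close>

definition PCE_instance ::
    "nat ring \<Rightarrow> nat \<Rightarrow> nat \<Rightarrow> nat list list \<Rightarrow> nat list list \<Rightarrow> nat list set \<Rightarrow> nat list set \<Rightarrow> bool" where
  "PCE_instance F n k A B C1 C2 \<longleftrightarrow>
     linear_code F n k C1 \<and> linear_code F n k C2 \<and>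
     generator_matrix F n k A C1 \<and> generator_matrix F n k B C2"

text \<open>Nothing is assumed about the answers to words that do not encode an instance.\<close>

definition PCE_oracle :: "nat ring \<Rightarrow> nat \<Rightarrow> (nat list \<Rightarrow> bool) \<Rightarrow> bool" where
  "PCE_oracle F q Q \<longleftrightarrow>
     (\<forall>n k A B C1 C2. PCE_instance F n k A B C1 C2 \<longrightarrow>
        (Q (encode q k n A B) \<longleftrightarrow> perm_equivalent n C1 C2))"

end

theory Submission
  imports Defs
begin

text \<open>
  Columns of the two generator matrices are matched one after the other. A candidate pair is tested
  by repeating the columns of both matrices so that the multiplicities encode the pairs chosen so
  far, and asking whether the repeated codes are equivalent. No field arithmetic is needed: the
  machine only copies entries and tests them for equality.

  Equal columns need care. When column \<open>l\<close> (counted from 0) is the first of its class of equal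
  columns it is repeated \<open>n (l + 1)\<close> times, all other columns stay single. If not all columns are
  equal, a class has at most \<open>n - 1\<close> members, so its total multiplicity determines both its size
  and its marked column, if any. An equivalence of the repeated codes therefore
  sends marked columns to their partners and classes to classes of equal size, and this is exactly
  what is needed for a permutation of the original coordinates that extends the chosen pairs.
\<close>

section \<open>Selections of coordinates\<close>

text \<open>The search never backtracks: each query decides exactly whether the current partial map
  extends to a full equivalence, and an extendable prefix always has an extendable successor. Each
  pair (i, j) is asked about at most once, hence n^2 queries. The obstacle is that a positive answer
  only says that some equivalence of the repeated codes exists. It acts through an unknown change of
  basis and shows no relation to the chosen pairs, so everything has to be recovered from the
  weights of the classes. One weight is ambiguous: n arises from n unmarked columns and from a
  single column marked at l = 0. In the first case all columns coincide, and comparing which column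
  values occur in the two codes settles it. Candidates are filtered before the query. Reusing a
  partner could give the two codes different lengths, outside the oracle's promise, and a partner
  that breaks equality of columns could put two marks into one class.\<close>

definition select :: "nat list \<Rightarrow> 'a list \<Rightarrow> 'a list" where
  "select ps v = map ((!) v) ps"

lemma length_select [simp]: "length (select ps v) = length ps"
  by (simp add: select_def)

lemma select_nth [simp]: "p < length ps \<Longrightarrow> select ps v ! p = v ! (ps ! p)"
  by (simp add: select_def)

lemma select_inj:
  assumes "set ps = {..<n}" "length v = n" "length w = n" "select ps v = select ps w"
  shows "v = w"
  using assms unfolding select_def by (intro nth_equalityI) auto

lemma select_carrier:
  assumes "set ps \<subseteq> {..<n}" "v \<in> carrier (coord_space F n)"
  shows "select ps v \<in> carrier (coord_space F (length ps))"
  using assms by (auto simp: select_def subset_iff)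

lemma select_add:
  assumes "set ps \<subseteq> {..<n}" "length v = n" "length w = n"
  shows "select ps (map2 f v w) = map2 f (select ps v) (select ps w)"
  using assms nth_mem by (intro nth_equalityI) fastforce+

lemma select_map:
  assumes "set ps \<subseteq> {..<n}" "length v = n"
  shows "select ps (map f v) = map f (select ps v)"
  using assms nth_mem by (intro nth_equalityI) fastforce+

lemma select_mod_hom:
  assumes "field F" "set ps \<subseteq> {..<n}"
  shows "mod_hom F (coord_space F n) (coord_space F (length ps)) (select ps)"
proof -
  interpret V: vectorspace F "coord_space F n" by (rule vectorspace_coord_space[OF assms(1)])
  interpret W: vectorspace F "coord_space F (length ps)"
    by (rule vectorspace_coord_space[OF assms(1)])
  have "select ps \<in> LinearCombinations.module_hom F (coord_space F n) (coord_space F (length ps))"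
    unfolding LinearCombinations.module_hom_def
  proof (intro CollectI conjI allI impI funcsetI)
    fix v assume "v \<in> carrier (coord_space F n)"
    then show "select ps v \<in> carrier (coord_space F (length ps))"
      by (rule select_carrier[OF assms(2)])
  next
    fix v w assume "v \<in> carrier (coord_space F n) \<and> w \<in> carrier (coord_space F n)"
    then show "select ps (v \<oplus>\<^bsub>coord_space F n\<^esub> w)
        = select ps v \<oplus>\<^bsub>coord_space F (length ps)\<^esub> select ps w"
      by (simp only: coord_space_simps mem_Collect_eq select_add[OF assms(2)])
  qed (simp add: select_map[OF assms(2)])
  then show ?thesis
    by (intro mod_hom.intro mod_hom_axioms.intro V.module_axioms W.module_axioms)
qed

section \<open>Submodules and spans under linear maps\<close>

lemma image_submodule:
  assumes "mod_hom R M N f" "submodule R S M"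
  shows "submodule R (f ` S) N"
proof -
  interpret mod_hom R M N f by fact
  interpret S: submodule R S M by fact
  note sub = subsetD[OF S.subset]
  show ?thesis
  proof
    show "f ` S \<subseteq> carrier N" using sub by auto
    show "\<zero>\<^bsub>N\<^esub> \<in> f ` S" using S.zero_closed by (metis f0_is_0 image_eqI)
  next
    fix v w assume "v \<in> f ` S" "w \<in> f ` S"
    then obtain a b where "v = f a" "w = f b" "a \<in> S" "b \<in> S" by auto
    then show "v \<oplus>\<^bsub>N\<^esub> w \<in> f ` S" using sub S.m_closed[of a b] by (metis f_add image_eqI)
  next
    fix c v assume "c \<in> carrier R" "v \<in> f ` S"
    then obtain a where "v = f a" "a \<in> S" by auto
    then show "c \<odot>\<^bsub>N\<^esub> v \<in> f ` S"
      using sub S.smult_closed[of c a] \<open>c \<in> carrier R\<close> by (metis f_smult image_eqI)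
  qed
qed

lemma preimage_submodule:
  assumes "mod_hom R M N f" "submodule R S N"
  shows "submodule R {v \<in> carrier M. f v \<in> S} M"
proof -
  interpret mod_hom R M N f by fact
  interpret S: submodule R S N by fact
  show ?thesis by unfold_locales (auto simp: S.m_closed S.smult_closed)
qed

text \<open>Both inclusions are the minimality of a span: the image of one span is a submodule
  containing the images of the generators, and the preimage of the other is a submodule containing
  \<open>S\<close>.\<close>

lemma span_image:
  assumes "mod_hom R M N f" "S \<subseteq> carrier M"
  shows "LinearCombinations.module.span R N (f ` S) = f ` LinearCombinations.module.span R M S"
proof -
  interpret mod_hom R M N f by fact
  have img: "f ` S \<subseteq> carrier N" using assms(2) by auto
  have "N.span (f ` S) \<subseteq> f ` M.span S"
    using image_submodule[OF assms(1) M.span_is_submodule[OF assms(2)]]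
    by (intro N.span_is_subset image_mono M.in_own_span assms(2))
  moreover have "M.span S \<subseteq> {v \<in> carrier M. f v \<in> N.span (f ` S)}"
    using preimage_submodule[OF assms(1) N.span_is_submodule[OF img]] assms(2)
      N.in_own_span[OF img]
    by (intro M.span_is_subset) auto
  ultimately show ?thesis by blast
qed

text \<open>Repeating columns is an injective linear map as long as no coordinate is dropped, so the
  dimension stays \<open>k\<close>. The oracle promises nothing about words that are not instances,
  so its answers become usable through this.\<close>

lemma select_instance:
  assumes F: "field F" and ps: "set ps = {..<n}"
    and lin: "linear_code F n k C" and gen: "generator_matrix F n k G C"
  shows "linear_code F (length ps) k (select ps ` C)"
    and "generator_matrix F (length ps) k (map (select ps) G) (select ps ` C)"
proof -
  let ?V = "coord_space F n" and ?W = "coord_space F (length ps)"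
  let ?T = "select ps"
  interpret V: vectorspace F ?V by (rule vectorspace_coord_space[OF F])
  interpret W: vectorspace F ?W by (rule vectorspace_coord_space[OF F])
  have hom: "mod_hom F ?V ?W ?T" by (rule select_mod_hom) (use F ps in auto)
  have rows: "set G \<subseteq> carrier ?V" and span: "V.span (set G) = C" and len: "length G = k"
    using gen by (auto simp: generator_matrix_def simp del: coord_space_simps)
  have subC: "submodule F C ?V" and dim: "vectorspace.dim F (V.vs C) = k"
    using lin by (auto simp: linear_code_def)
  have subD: "submodule F (?T ` C) ?W" by (rule image_submodule[OF hom subC])
  have CV: "C \<subseteq> carrier ?V" using subC by (rule submodule.subset)
  have sC: "VectorSpace.subspace F C ?V" and sD: "VectorSpace.subspace F (?T ` C) ?W"
    using subC subD V.vectorspace_axioms W.vectorspace_axioms by (auto simp: VectorSpace.subspace_def)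
  interpret C: vectorspace F "V.vs C" by (rule V.subspace_is_vs[OF sC])
  interpret D: vectorspace F "W.vs (?T ` C)" by (rule W.subspace_is_vs[OF sD])
  have "?T \<in> LinearCombinations.module_hom F (V.vs C) (W.vs (?T ` C))"
    using mod_hom.f_hom[OF hom] subsetD[OF CV]
    unfolding LinearCombinations.module_hom_def by (auto simp del: coord_space_simps)
  then interpret T: linear_map F "V.vs C" "W.vs (?T ` C)" ?T
    by (intro linear_map.intro mod_hom.intro mod_hom_axioms.intro
        C.vectorspace_axioms D.vectorspace_axioms C.module_axioms D.module_axioms)
  \<comment> \<open>\<open>T.dim_eq\<close> wants a finite-dimensional domain; the rows of
    \<open>G\<close> span \<open>C\<close> also when the span is formed inside
    \<open>C\<close>.\<close>
  have "C.span (set G) = C"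
    using V.span_li_not_depend(1)[OF _ subC, of "set G"] span V.in_own_span[OF rows] by simp
  then have "C.fin_dim"
    unfolding C.fin_dim_def using V.in_own_span[OF rows] span
    by (intro exI[of _ "set G"]) simp
  moreover have "inj_on ?T (carrier (V.vs C))"
    using CV ps by (auto intro!: inj_onI dest: select_inj)
  ultimately have "C.dim = D.dim" by (intro T.dim_eq) auto
  then show "linear_code F (length ps) k (?T ` C)"
    using dim sD by (simp add: linear_code_def)
  show "generator_matrix F (length ps) k (map ?T G) (?T ` C)"
    unfolding generator_matrix_def
    using span_image[OF hom rows] span len rows select_carrier[of ps n _ F] ps
    by (auto simp del: coord_space_simps)
qed

text \<open>Agreement of two coordinates is a linear condition, so it can be read off the rows.\<close>

lemma columns_agree_iff:
  assumes F: "field F" and "l < n" "l' < n" and gen: "generator_matrix F n k G C"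
  shows "(\<forall>c\<in>C. c ! l = c ! l') \<longleftrightarrow> (\<forall>r<k. G ! r ! l = G ! r ! l')"
proof -
  let ?V = "coord_space F n"
  interpret V: vectorspace F ?V by (rule vectorspace_coord_space[OF F])
  have rows: "set G \<subseteq> carrier ?V" and span: "V.span (set G) = C" and len: "length G = k"
    using gen by (auto simp: generator_matrix_def simp del: coord_space_simps)
  have "submodule F {c \<in> carrier ?V. c ! l = c ! l'} ?V"
    using assms(2,3) V.M.zero_closed V.M.add.m_closed V.smult_closed
    by (unfold_locales) (auto simp del: V.M.zero_closed)
  then have "C \<subseteq> {c \<in> carrier ?V. c ! l = c ! l'}"
    if "\<forall>g\<in>set G. g ! l = g ! l'"
    unfolding span[symmetric] using that rows by (intro V.span_is_subset) auto
  moreover have "set G \<subseteq> C" using V.in_own_span[OF rows] span by simp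
  moreover have "(\<forall>r<k. G ! r ! l = G ! r ! l') \<longleftrightarrow> (\<forall>g\<in>set G. g ! l = g ! l')"
    using len by (auto simp: all_set_conv_all_nth)
  ultimately show ?thesis by blast
qed

section \<open>Permutation equivalence in terms of columns\<close>

text \<open>
  Columns are taken over all codewords instead of the rows of a generator matrix, so that equivalent
  codes can be compared without a change of basis.
\<close>

definition col :: "'b set \<Rightarrow> ('b \<Rightarrow> 'a list) \<Rightarrow> nat \<Rightarrow> 'b \<Rightarrow> 'a" where
  "col C \<phi> l = restrict (\<lambda>c. \<phi> c ! l) C"

lemma col_eq_iff: "col C \<phi> l = col C \<psi> j \<longleftrightarrow> (\<forall>c\<in>C. \<phi> c ! l = \<psi> c ! j)"
  unfolding col_def restrict_def by (metis (mono_tags))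

lemma length_act [simp]: "length (act \<pi> x) = length x"
  by (simp add: act_def)

lemma act_eq_iff:
  assumes "\<pi> permutes {..<length x}"
  shows "act \<pi> x = y \<longleftrightarrow> length y = length x \<and> (\<forall>p<length x. y ! \<pi> p = x ! p)"
proof
  assume "length y = length x \<and> (\<forall>p<length x. y ! \<pi> p = x ! p)"
  then have "act \<pi> x ! p = y ! p" if "p < length x" for p
    using that act_nth[OF assms] permutes_inverses(1)[OF assms]
      permutes_in_image[OF permutes_inv[OF assms], of p]
    by (metis lessThan_iff)
  then show "act \<pi> x = y"
    using \<open>length y = length x \<and> _\<close> by (intro nth_equalityI) auto
qed (use act_nth[OF assms] in auto)

text \<open>The map \<open>\<phi>\<close> pairs each word with its image and so absorbs the change
  of basis. All columns become functions on the same set \<open>C1\<close>, and a permutation of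
  positions between two lists exists exactly when they agree as multisets.\<close>

lemma perm_equivalent_select_iff:
  assumes C1: "\<And>c. c \<in> C1 \<Longrightarrow> length c = n" and C2: "\<And>c. c \<in> C2 \<Longrightarrow> length c = n"
    and ps: "length ps = m" and qs: "set qs = {..<n}" "length qs = m"
  shows "perm_equivalent m (select ps ` C1) (select qs ` C2) \<longleftrightarrow>
    (\<exists>\<phi>. \<phi> ` C1 = C2 \<and> image_mset (col C1 id) (mset ps) = image_mset (col C1 \<phi>) (mset qs))"
proof
  assume "perm_equivalent m (select ps ` C1) (select qs ` C2)"
  then obtain \<tau> where \<tau>: "\<tau> permutes {..<m}" "select qs ` C2 = act \<tau> ` select ps ` C1"
    by (auto simp: perm_equivalent_def)
  then have "\<forall>c\<in>C1. \<exists>c'\<in>C2. select qs c' = act \<tau> (select ps c)" by (metis imageE imageI)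
  then obtain \<phi> where \<phi>: "\<And>c. c \<in> C1 \<Longrightarrow> \<phi> c \<in> C2"
    "\<And>c. c \<in> C1 \<Longrightarrow> select qs (\<phi> c) = act \<tau> (select ps c)"
    by metis
  have "c' \<in> \<phi> ` C1" if c': "c' \<in> C2" for c'
  proof -
    from c' \<tau>(2) obtain c where "c \<in> C1" "select qs c' = act \<tau> (select ps c)" by blast
    \<comment> \<open>A word of \<open>C2\<close> is determined by its selection because
      \<open>qs\<close> meets every coordinate; hence \<open>c'\<close> is the word chosen for
      \<open>c\<close>.\<close>
    then show ?thesis using \<phi> select_inj[OF qs(1)] C2 c' by (metis imageI)
  qed
  then have img: "\<phi> ` C1 = C2" using \<phi>(1) by blast
  have "map (col C1 id) ps = permute_list \<tau> (map (col C1 \<phi>) qs)"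
  proof (rule nth_equalityI)
    fix p assume "p < length (map (col C1 id) ps)"
    then have p: "p < m" using ps by simp
    have \<tau>p: "\<tau> p < m" using permutes_in_image[OF \<tau>(1)] p by simp
    have "\<phi> c ! (qs ! \<tau> p) = c ! (ps ! p)" if "c \<in> C1" for c
      using arg_cong[OF \<phi>(2)[OF that], of "\<lambda>x. x ! \<tau> p"] act_nth[of \<tau> "select ps c" p] \<tau>(1) p \<tau>p ps qs(2)
      by simp
    then show "map (col C1 id) ps ! p = permute_list \<tau> (map (col C1 \<phi>) qs) ! p"
      using p \<tau> \<tau>p ps qs(2) by (simp add: permute_list_nth col_eq_iff)
  qed (use ps qs in simp)
  then have "mset (map (col C1 id) ps) = mset (map (col C1 \<phi>) qs)"
    using \<tau>(1) qs(2) by simp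
  then show "\<exists>\<phi>. \<phi> ` C1 = C2 \<and>
      image_mset (col C1 id) (mset ps) = image_mset (col C1 \<phi>) (mset qs)"
    using img by auto
next
  assume "\<exists>\<phi>. \<phi> ` C1 = C2 \<and>
    image_mset (col C1 id) (mset ps) = image_mset (col C1 \<phi>) (mset qs)"
  then obtain \<phi> where img: "\<phi> ` C1 = C2"
    and "mset (map (col C1 id) ps) = mset (map (col C1 \<phi>) qs)"
    by auto
  then obtain \<tau> where \<tau>: "\<tau> permutes {..<m}"
    "permute_list \<tau> (map (col C1 \<phi>) qs) = map (col C1 id) ps"
    using qs(2) by (metis mset_eq_permutation length_map)
  have "act \<tau> (select ps c) = select qs (\<phi> c)" if c: "c \<in> C1" for c
  proof -
    have "select qs (\<phi> c) ! \<tau> p = select ps c ! p" if p: "p < m" for p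
    proof -
      have \<tau>p: "\<tau> p < m" using permutes_in_image[OF \<tau>(1)] p by simp
      have "col C1 \<phi> (qs ! \<tau> p) = col C1 id (ps ! p)"
        using arg_cong[OF \<tau>(2), of "\<lambda>xs. xs ! p"] \<tau>(1) p \<tau>p ps qs(2)
        by (simp add: permute_list_nth)
      then show ?thesis using c p \<tau>p ps qs(2) by (simp add: col_eq_iff)
    qed
    then show ?thesis using \<tau>(1) ps qs(2) by (subst act_eq_iff) auto
  qed
  then have "select qs ` C2 = act \<tau> ` select ps ` C1"
    unfolding img[symmetric] image_image by simp
  then show "perm_equivalent m (select ps ` C1) (select qs ` C2)"
    using \<tau>(1) by (auto simp: perm_equivalent_def)
qed

section \<open>Marking columns by multiplicities\<close>

text \<open>Copies of a column stay adjacent and in order, as in the rows written by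
  \<open>put_matrix\<close>.\<close>

definition positions :: "(nat \<Rightarrow> nat) \<Rightarrow> nat \<Rightarrow> nat list" where
  "positions W n = concat (map (\<lambda>l. replicate (W l) l) [0..<n])"

lemma length_positions: "length (positions W n) = (\<Sum>l<n. W l)"
  by (induction n) (simp_all add: positions_def)

lemma set_positions: "(\<And>l. l < n \<Longrightarrow> W l > 0) \<Longrightarrow> set (positions W n) = {..<n}"
  by (auto simp: positions_def)

text \<open>Turns the multiset equation behind a positive answer into one equation of class weights
  per column value.\<close>

lemma count_image_positions:
  "count (image_mset u (mset (positions W n))) x = (\<Sum>l<n. if u l = x then W l else 0)"
  by (induction n) (auto simp: positions_def)

text \<open>The classes of equal labels partition both sides, so bijections chosen class by class
  glue together.\<close>

lemma exists_bij_preserving_labels: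
  assumes "finite A" "finite B"
    and "\<And>x. card {a \<in> A. u a = x} = card {b \<in> B. v b = x}"
  shows "\<exists>f. bij_betw f A B \<and> (\<forall>a\<in>A. v (f a) = u a)"
proof -
  have "\<exists>g. bij_betw g {a \<in> A. u a = x} {b \<in> B. v b = x}" for x
    using assms by (intro finite_same_card_bij) auto
  then obtain g where g: "\<And>x. bij_betw (g x) {a \<in> A. u a = x} {b \<in> B. v b = x}" by metis
  define f where "f a = g (u a) a" for a
  have f: "f a \<in> B" "v (f a) = u a" if "a \<in> A" for a
    using bij_betwE[OF g[of "u a"]] that by (auto simp: f_def)
  have "inj_on f A"
  proof (rule inj_onI)
    fix a b assume ab: "a \<in> A" "b \<in> A" "f a = f b"
    then have "u a = u b" using f by metis
    then show "a = b"
      using ab bij_betw_imp_inj_on[OF g[of "u a"]] by (auto simp: f_def dest: inj_onD)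
  qed
  moreover have "B \<subseteq> f ` A"
  proof
    fix b assume "b \<in> B"
    then have "b \<in> g (v b) ` {a \<in> A. u a = v b}"
      using bij_betw_imp_surj_on[OF g[of "v b"]] by auto
    then obtain a where "a \<in> A" "u a = v b" "b = g (v b) a" by blast
    then show "b \<in> f ` A" by (auto simp: f_def intro!: rev_image_eqI)
  qed
  ultimately show ?thesis using f by (auto simp: bij_betw_def)
qed

text \<open>The prefix uses up equally many members of each class on both sides, since
  \<open>\<pi>\<close> respects labels. What remains of the classes still has equal sizes and can be
  matched freely.\<close>

lemma extend_injection_preserving_labels:
  fixes u v :: "nat \<Rightarrow> 'b"
  assumes i: "i \<le> n" and inj: "inj_on \<pi> {..<i}" and img: "\<pi> ` {..<i} \<subseteq> {..<n}"
    and lab: "\<And>l. l < i \<Longrightarrow> v (\<pi> l) = u l"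
    and card: "\<And>x. card {l. l < n \<and> u l = x} = card {j. j < n \<and> v j = x}"
  shows "\<exists>\<sigma>. \<sigma> permutes {..<n} \<and> (\<forall>l<i. \<sigma> l = \<pi> l) \<and> (\<forall>l<n. v (\<sigma> l) = u l)"
proof -
  let ?A = "{i..<n}" and ?B = "{..<n} - \<pi> ` {..<i}"
  have "card {l \<in> ?A. u l = x} = card {j \<in> ?B. v j = x}" for x
  proof -
    have "{l \<in> ?A. u l = x} = {l. l < n \<and> u l = x} - {l. l < i \<and> u l = x}" using i by auto
    moreover have "{j \<in> ?B. v j = x} = {j. j < n \<and> v j = x} - \<pi> ` {l. l < i \<and> u l = x}"
      using lab by auto
    moreover have "card (\<pi> ` {l. l < i \<and> u l = x}) = card {l. l < i \<and> u l = x}"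
      using inj by (intro card_image) (auto simp: inj_on_def)
    moreover have "{l. l < i \<and> u l = x} \<subseteq> {l. l < n \<and> u l = x}"
      "\<pi> ` {l. l < i \<and> u l = x} \<subseteq> {j. j < n \<and> v j = x}"
      using i img lab by auto
    ultimately show ?thesis using card[of x] by (simp add: card_Diff_subset)
  qed
  then obtain f where f: "bij_betw f ?A ?B" "\<forall>l\<in>?A. v (f l) = u l"
    using exists_bij_preserving_labels[of ?A ?B u v] by auto
  define \<sigma> where "\<sigma> l = (if l < i then \<pi> l else if l < n then f l else l)" for l
  have "bij_betw \<sigma> ({..<i} \<union> {i..<n}) (\<pi> ` {..<i} \<union> ?B)"
  proof (rule bij_betw_combine)
    show "bij_betw \<sigma> {..<i} (\<pi> ` {..<i})"
      using inj by (subst bij_betw_cong[of _ _ \<pi>]) (auto simp: \<sigma>_def bij_betw_def)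
    show "bij_betw \<sigma> ?A ?B"
      using f(1) by (subst bij_betw_cong[of _ _ f]) (auto simp: \<sigma>_def)
  qed auto
  moreover have "{..<i} \<union> {i..<n} = {..<n}" "\<pi> ` {..<i} \<union> ?B = {..<n}" using i img by auto
  ultimately have "\<sigma> permutes {..<n}"
    using i by (intro bij_imp_permutes) (auto simp: \<sigma>_def)
  moreover have "\<forall>l<n. v (\<sigma> l) = u l" using lab f(2) by (auto simp: \<sigma>_def)
  ultimately show ?thesis by (intro exI[of _ \<sigma>]) (auto simp: \<sigma>_def)
qed

definition fresh :: "(nat \<Rightarrow> 'b) \<Rightarrow> nat \<Rightarrow> bool" where
  "fresh u l \<longleftrightarrow> (\<forall>l'<l. u l' \<noteq> u l)"

lemma freshE:
  obtains l' where "l' \<le> l" "fresh u l'" "u l' = u l"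
proof -
  define m where "m = (LEAST m. u m = u l)"
  have "u m = u l" unfolding m_def by (rule LeastI[of _ l]) simp
  moreover have "m \<le> l" unfolding m_def by (rule Least_le) simp
  moreover have "u m' \<noteq> u l" if "m' < m" for m' using not_less_Least[of m' "\<lambda>m. u m = u l"] that by (simp add: m_def)
  ultimately show ?thesis using that[of m] by (auto simp: fresh_def)
qed

text \<open>
  Marking one column per class only keeps the weight of a class with mark \<open>n * (l + 1)\<close> in the
  interval from \<open>n * (l + 1)\<close> to \<open>n * (l + 1) + n - 1\<close>, so that the mark and the size of the class
  can both be recovered from it. Repeating \<^emph>\<open>every\<close> column by a distinct multiple of \<open>n\<close> would not
  do: the marks of identical columns add up and may collide.
\<close>

definition mark :: "(nat \<Rightarrow> 'b) \<Rightarrow> nat \<Rightarrow> nat \<Rightarrow> nat \<Rightarrow> nat" where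
  "mark u n i l = (if l < i \<and> fresh u l then n * (l + 1) else 1)"

lemma mark_pos: "l < n \<Longrightarrow> mark u n i l > 0"
  by (auto simp: mark_def)

text \<open>Source of the length bound in the theorem: \<open>n\<close> times the triangular number
  of \<open>n\<close>, the total if every column were marked.\<close>

lemma sum_mark_le: "(\<Sum>l<n. mark u n i l) \<le> n\<^sup>2 * (n + 1) div 2"
proof -
  have "(\<Sum>l<n. mark u n i l) \<le> (\<Sum>l<n. n * (l + 1))"
    by (intro sum_mono) (auto simp: mark_def)
  also have "\<dots> = n * (\<Sum>l<n. l + 1)" by (simp add: sum_distrib_left)
  also have "n * (\<Sum>l<n. l + 1) = n\<^sup>2 * (n + 1) div 2"
  proof -
    have gauss: "2 * (\<Sum>l<m. l + 1) = m * (m + 1)" for m :: nat by (induction m) auto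
    have "n\<^sup>2 * (n + 1) = n * (n * (n + 1))" by (simp add: power2_eq_square algebra_simps)
    also have "\<dots> = 2 * (n * (\<Sum>l<n. l + 1))" by (simp only: gauss[of n, symmetric] mult.left_commute)
    finally show ?thesis by simp
  qed
  finally show ?thesis .
qed

text \<open>On either side the weight of a class is its size plus the surplus of its mark, if any.
  Decoding the common weight identifies both; agreement at the marked representatives then spreads
  to the whole prefix by \<open>same\<close>.\<close>

lemma marked_columns_match:
  fixes u v :: "nat \<Rightarrow> 'b"
  assumes cnt: "\<And>x. (\<Sum>l<n. if u l = x then mark u n i l else 0) = (\<Sum>j<n. if v j = x then V j else 0)"
    and i: "i \<le> n" and inj: "inj_on \<pi> {..<i}" and img: "\<pi> ` {..<i} \<subseteq> {..<n}"
    and same: "\<And>l l'. l < i \<Longrightarrow> l' < i \<Longrightarrow> u l = u l' \<longleftrightarrow> v (\<pi> l) = v (\<pi> l')"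
    and V: "\<And>l. l < i \<Longrightarrow> V (\<pi> l) = mark u n i l"
    and V1: "\<And>j. j < n \<Longrightarrow> j \<notin> \<pi> ` {..<i} \<Longrightarrow> V j = 1"
  shows "(\<forall>l<i. v (\<pi> l) = u l) \<and> (\<forall>x. card {l. l < n \<and> u l = x} = card {j. j < n \<and> v j = x})"
proof -
  define a b where "a x = card {l. l < n \<and> u l = x}" and "b x = card {j. j < n \<and> v j = x}" for x
  define M where "M x = {l. l < i \<and> fresh u l \<and> u l = x}" for x
  \<comment> \<open>Freshness refers to \<open>u\<close> even here, since the marks of the second
    code are copies of those of the first along \<open>\<pi>\<close>.\<close>
  define N where "N x = {l. l < i \<and> fresh u l \<and> v (\<pi> l) = x}" for x
  \<comment> \<open>The surplus of a mark over the single copy that every column has anyway.\<close>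
  let ?e = "\<lambda>l. n * (l + 1) - 1"
  define A where "A x = a x + sum ?e (M x)" for x
  have finM: "finite (M x)" "finite (N x)" for x by (auto simp: M_def N_def)
  have card_sum: "card {l. l < n \<and> P l} = (\<Sum>l<n. if P l then 1 else 0)" for P
    by (simp add: sum.If_cases Int_def)
  have "(\<Sum>l<n. if u l = x then mark u n i l else 0) = A x" for x
  proof -
    have "(\<Sum>l<n. if u l = x then mark u n i l else 0)
        = (\<Sum>l<n. (if u l = x then 1 else 0) + (if l \<in> M x then ?e l else 0))"
      by (intro sum.cong) (auto simp: mark_def M_def)
    also have "\<dots> = a x + (\<Sum>l<n. if l \<in> M x then ?e l else 0)"
      by (simp add: sum.distrib a_def card_sum)
    also have "(\<Sum>l<n. if l \<in> M x then ?e l else 0) = sum ?e ({..<n} \<inter> M x)"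
      by (subst sum.inter_restrict) auto
    also have "{..<n} \<inter> M x = M x" using i by (auto simp: M_def)
    finally show ?thesis by (simp add: A_def)
  qed
  moreover have "(\<Sum>j<n. if v j = x then V j else 0) = b x + sum ?e (N x)" for x
  proof -
    have "(\<Sum>j<n. if v j = x then V j else 0)
        = (\<Sum>j<n. (if v j = x then 1 else 0) + (if j \<in> \<pi> ` {..<i} \<and> v j = x then V j - 1 else 0))"
      using V V1 by (intro sum.cong) (auto simp: mark_def)
    also have "\<dots> = b x + (\<Sum>j<n. if j \<in> \<pi> ` {..<i} \<and> v j = x then V j - 1 else 0)"
      by (simp add: sum.distrib b_def card_sum)
    also have "(\<Sum>j<n. if j \<in> \<pi> ` {..<i} \<and> v j = x then V j - 1 else 0)
        = (\<Sum>j\<in>\<pi> ` {..<i}. if v j = x then V j - 1 else 0)"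
      using img by (intro sum.mono_neutral_cong_right) auto
    also have "\<dots> = (\<Sum>l<i. if v (\<pi> l) = x then V (\<pi> l) - 1 else 0)"
      by (rule sum.reindex_cong[OF inj]) auto
    also have "\<dots> = (\<Sum>l<i. if l \<in> N x then ?e l else 0)"
      using V by (intro sum.cong) (auto simp: mark_def N_def)
    also have "\<dots> = sum ?e ({..<i} \<inter> N x)"
      by (subst sum.inter_restrict) auto
    also have "{..<i} \<inter> N x = N x" by (auto simp: N_def)
    finally show ?thesis .
  qed
  ultimately have AB: "A x = b x + sum ?e (N x)" for x using cnt by simp
  have a0: "a x = 0 \<Longrightarrow> M x = {}" for x using i by (auto simp: a_def M_def)
  have b0: "b x = 0 \<Longrightarrow> N x = {}" for x using img by (auto simp: b_def N_def)
  \<comment> \<open>A mark needs a column to sit on, so weight 0 means an empty class: both codes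
    show the same column values.\<close>
  have ab0: "a x = 0 \<longleftrightarrow> b x = 0" for x
    using AB[of x] a0[of x] b0[of x] by (auto simp: A_def)
  have singleM: "M x = {} \<or> (\<exists>l<i. M x = {l})" for x
  proof (cases "M x = {}")
    case False
    then obtain l where l: "l \<in> M x" by auto
    have "l' = l" if "l' \<in> M x" for l'
      using that l by (cases l' l rule: linorder_cases) (auto simp: M_def fresh_def)
    then show ?thesis using l by (auto simp: M_def)
  qed auto
  have singleN: "N x = {} \<or> (\<exists>l<i. N x = {l})" for x
  proof (cases "N x = {}")
    case False
    then obtain l where l: "l \<in> N x" by auto
    \<comment> \<open>Two marks in one class of the second code come from one class of the first, by
      \<open>same\<close>, and there only the least index is fresh.\<close>
    have "l' = l" if "l' \<in> N x" for l'
    proof -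
      have "u l' = u l" using that l same[of l' l] by (auto simp: N_def)
      then show ?thesis
        using that l by (cases l' l rule: linorder_cases) (auto simp: N_def fresh_def)
    qed
    then show ?thesis using l by (auto simp: N_def)
  qed auto
  have full: "c x = n \<Longrightarrow> y \<noteq> x \<Longrightarrow> c y = 0"
    if c: "\<And>x. c x = card {l. l < n \<and> w l = x}" for c :: "'b \<Rightarrow> nat" and w x y
  proof -
    assume "c x = n" "y \<noteq> x"
    then have "{l. l < n \<and> w l = x} = {..<n}" using c[of x] by (intro card_subset_eq) auto
    then show "c y = 0" using c[of y] \<open>y \<noteq> x\<close> by auto
  qed
  have total: "(\<And>y. y \<noteq> x \<Longrightarrow> c y = 0) \<Longrightarrow> c x = n"
    if c: "\<And>x. c x = card {l. l < n \<and> w l = x}" for c :: "'b \<Rightarrow> nat" and w x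
  proof -
    assume *: "\<And>y. y \<noteq> x \<Longrightarrow> c y = 0"
    have "w l = x" if "l < n" for l
      using *[of "w l"] c[of "w l"] that by auto
    then have "{l. l < n \<and> w l = x} = {..<n}" by auto
    then show "c x = n" using c[of x] by simp
  qed
  have le: "a x \<le> n" "b x \<le> n" for x
    using card_mono[of "{..<n}" "{l. l < n \<and> u l = x}"]
      card_mono[of "{..<n}" "{l. l < n \<and> v l = x}"] by (auto simp: a_def b_def)
  \<comment> \<open>A class of size \<open>n\<close> is the only class of its code, a property that
    \<open>ab0\<close> transfers. This disposes of the ambiguous weight \<open>n\<close>.\<close>
  have fullab: "a x = n \<longleftrightarrow> b x = n" for x
    using full[of a u x, OF a_def] full[of b v x, OF b_def] total[of a u x, OF a_def]
      total[of b v x, OF b_def] ab0 by blast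
  have key: "a x = b x \<and> M x = N x" for x
  proof (cases "a x = n")
    case True
    then have "b x = n" using fullab by simp
    have "u l = x" if "l < n" for l
      using full[of a u x "u l", OF a_def True] that by (auto simp: a_def)
    moreover have "v l = x" if "l < n" for l
      using full[of b v x "v l", OF b_def \<open>b x = n\<close>] that by (auto simp: b_def)
    ultimately have "M x = N x" using i img by (auto simp: M_def N_def)
    then show ?thesis using True \<open>b x = n\<close> by simp
  next
    case False
    show ?thesis
    proof (cases "a x = 0")
      case True
      then show ?thesis using ab0 a0 b0 by simp
    next
      case a: False
      have lt: "a x < n" "b x < n" "0 < a x" "0 < b x"
        using False a fullab ab0 le[of x] by (auto simp: order.not_eq_order_implies_strict)
      have eq: "a x + sum ?e (M x) = b x + sum ?e (N x)" using AB[of x] by (simp add: A_def)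
      \<comment> \<open>For class sizes strictly between 0 and \<open>n\<close>, a weight below
        \<open>n\<close> means that there is no mark.\<close>
      have big: "a' + ?e l \<ge> n" if "0 < a'" for a' l using that lt by (cases a') auto
      \<comment> \<open>The quotient by \<open>n\<close> reveals the mark and the remainder the
        size. The shift by one occurs because the copy of the marked column itself is part of
        \<open>n * (l + 1)\<close>.\<close>
      have dv: "(a' + ?e l) div n = l + 1 \<and> (a' + ?e l) mod n = a' - 1" if "0 < a'" "a' < n" for a' l
      proof -
        have "a' + ?e l = (a' - 1) + n * (l + 1)" using that by (cases a'; cases n) auto
        moreover have "(c + n * d) div n = d \<and> (c + n * d) mod n = c" if "c < n" for c d
          using that by auto
        from this[of "a' - 1" "l + 1"] have "((a' - 1) + n * (l + 1)) div n = l + 1 \<and>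
            ((a' - 1) + n * (l + 1)) mod n = a' - 1" using that by simp
        ultimately show ?thesis by metis
      qed
      consider "M x = {}" "N x = {}" | l where "M x = {}" "N x = {l}" | l where "M x = {l}" "N x = {}"
        | l l' where "M x = {l}" "N x = {l'}" using singleM[of x] singleN[of x] by blast
      then show ?thesis
      proof cases
        case 4
        then have e: "a x + ?e l = b x + ?e l'" using eq by simp
        have "l = l'" using dv[OF lt(3,1), of l] dv[OF lt(4,2), of l'] e by simp
        then show ?thesis using e 4 by simp
      next
        case (2 l) then show ?thesis using eq big[OF lt(4), of l] lt by simp
      next
        case (3 l) then show ?thesis using eq big[OF lt(3), of l] lt by simp
      qed (use eq in auto)
    qed
  qed
  \<comment> \<open>Only fresh indices carry marks; any other prefix column inherits the conclusion
    from the representative of its class.\<close>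
  have "v (\<pi> l) = u l" if l: "l < i" for l
  proof -
    obtain l' where l': "l' \<le> l" "fresh u l'" "u l' = u l" by (rule freshE)
    then have "l' \<in> M (u l)" using l by (auto simp: M_def)
    then have "v (\<pi> l') = u l" using key by (auto simp: N_def)
    then show ?thesis using same[of l' l] l l' by auto
  qed
  then show ?thesis using key by (auto simp: a_def b_def)
qed

section \<open>Partial solutions\<close>

text \<open>At \<open>i = 0\<close> this is permutation equivalence; at \<open>i = n\<close> the
  values of \<open>\<pi>\<close> below \<open>n\<close> are a solution.\<close>

definition extendable :: "nat \<Rightarrow> 'a list set \<Rightarrow> 'a list set \<Rightarrow> nat \<Rightarrow> (nat \<Rightarrow> nat) \<Rightarrow> bool" where
  "extendable n C1 C2 i \<pi> \<longleftrightarrow>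
    (\<exists>\<sigma>. \<sigma> permutes {..<n} \<and> (\<forall>l<i. \<sigma> l = \<pi> l) \<and> act \<sigma> ` C1 = C2)"

lemma extendable_same_col:
  assumes "extendable n C1 C2 i \<pi>" "\<And>c. c \<in> C1 \<Longrightarrow> length c = n" "l < i" "l' < i" "i \<le> n"
  shows "col C1 id l = col C1 id l' \<longleftrightarrow> col C2 id (\<pi> l) = col C2 id (\<pi> l')"
proof -
  obtain \<sigma> where \<sigma>: "\<sigma> permutes {..<n}" "\<forall>l<i. \<sigma> l = \<pi> l" "C2 = act \<sigma> ` C1"
    using assms(1) by (auto simp: extendable_def)
  have "act \<sigma> c ! \<pi> l = c ! l" if "c \<in> C1" "l < i" for c l
    using act_nth[of \<sigma> c l] \<sigma> assms(2)[OF that(1)] that(2) assms(5) by auto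
  then show ?thesis using assms(3,4) \<sigma>(3) by (auto simp: col_eq_iff)
qed

lemma extendable_inj:
  assumes "extendable n C1 C2 i \<pi>" "i \<le> n"
  shows "inj_on \<pi> {..<i}" "\<pi> ` {..<i} \<subseteq> {..<n}"
proof -
  obtain \<sigma> where \<sigma>: "\<sigma> permutes {..<n}" "\<forall>l<i. \<sigma> l = \<pi> l"
    using assms(1) by (auto simp: extendable_def)
  then show "inj_on \<pi> {..<i}"
    using inj_on_subset[OF permutes_inj[OF \<sigma>(1)], of "{..<i}"] inj_on_cong[of "{..<i}" \<sigma> \<pi>] by simp
  show "\<pi> ` {..<i} \<subseteq> {..<n}"
  proof (intro image_subsetI)
    fix l assume "l \<in> {..<i}"
    then have "\<sigma> l \<in> {..<n}" "\<sigma> l = \<pi> l"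
      using \<sigma>(2) assms(2) permutes_in_image[OF \<sigma>(1), of l] by auto
    then show "\<pi> l \<in> {..<n}" by simp
  qed
qed

lemma extendable_cong:
  "(\<And>l. l < i \<Longrightarrow> \<pi> l = \<pi>' l) \<Longrightarrow> extendable n C1 C2 i \<pi> \<longleftrightarrow> extendable n C1 C2 i \<pi>'"
  unfolding extendable_def by metis

lemma extendable_Suc:
  assumes "extendable n C1 C2 i \<pi>" "i < n"
  obtains j where "j < n" "extendable n C1 C2 (Suc i) (\<pi>(i := j))"
proof -
  obtain \<sigma> where \<sigma>: "\<sigma> permutes {..<n}" "\<forall>l<i. \<sigma> l = \<pi> l" "act \<sigma> ` C1 = C2"
    using assms(1) by (auto simp: extendable_def)
  show ?thesis
  proof (rule that[of "\<sigma> i"])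
    show "\<sigma> i < n" using permutes_in_image[OF \<sigma>(1), of i] assms(2) by simp
    show "extendable n C1 C2 (Suc i) (\<pi>(i := \<sigma> i))"
      unfolding extendable_def using \<sigma> by (intro exI[of _ \<sigma>]) auto
  qed
qed

text \<open>The equivalence behind a positive answer is not known to follow the chosen pairs. Only
  its word map \<open>\<phi>\<close> is kept: the class weights force \<open>\<phi>\<close> to
  respect the pairs, and then some permutation extending \<open>\<pi>\<close> induces
  \<open>\<phi>\<close>.\<close>

lemma perm_equivalent_marked_iff:
  fixes C1 C2 :: "'a list set"
  defines "u \<equiv> col C1 id"
  assumes C1: "\<And>c. c \<in> C1 \<Longrightarrow> length c = n" and C2: "\<And>c. c \<in> C2 \<Longrightarrow> length c = n"
    and i: "i \<le> n" and inj: "inj_on \<pi> {..<i}" and img: "\<pi> ` {..<i} \<subseteq> {..<n}"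
    and same: "\<And>l l'. l < i \<Longrightarrow> l' < i \<Longrightarrow>
      u l = u l' \<longleftrightarrow> col C2 id (\<pi> l) = col C2 id (\<pi> l')"
    and V: "\<And>l. l < i \<Longrightarrow> V (\<pi> l) = mark u n i l"
    and V1: "\<And>j. j < n \<Longrightarrow> j \<notin> \<pi> ` {..<i} \<Longrightarrow> V j = 1"
    and m: "length (positions (mark u n i) n) = m" "length (positions V n) = m"
  shows "perm_equivalent m (select (positions (mark u n i) n) ` C1) (select (positions V n) ` C2)
    \<longleftrightarrow> extendable n C1 C2 i \<pi>"
proof -
  have "0 < V j" if "j < n" for j
  proof (cases "j \<in> \<pi> ` {..<i}")
    case True
    then obtain l where "l < i" "j = \<pi> l" by auto
    then show ?thesis using V i mark_pos[of l n u i] by simp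
  qed (use V1 that in simp)
  then have "set (positions V n) = {..<n}" by (rule set_positions)
  note iff = perm_equivalent_select_iff[OF C1 C2 m(1) this m(2)]
  show ?thesis
  proof
    assume "perm_equivalent m (select (positions (mark u n i) n) ` C1) (select (positions V n) ` C2)"
    then obtain \<phi> where \<phi>: "\<phi> ` C1 = C2"
      "image_mset u (mset (positions (mark u n i) n)) = image_mset (col C1 \<phi>) (mset (positions V n))"
      using iff unfolding u_def by blast
    have cnt: "(\<Sum>l<n. if u l = x then mark u n i l else 0)
        = (\<Sum>j<n. if col C1 \<phi> j = x then V j else 0)" for x
      using arg_cong[OF \<phi>(2), of "\<lambda>M. count M x"] unfolding count_image_positions .
    \<comment> \<open>\<open>same\<close> speaks about columns of \<open>C2\<close>; reindexing the
      words through \<open>\<phi>\<close> does not change which of them are equal.\<close>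
    have same': "u l = u l' \<longleftrightarrow> col C1 \<phi> (\<pi> l) = col C1 \<phi> (\<pi> l')" if "l < i" "l' < i" for l l'
      unfolding same[OF that] \<phi>(1)[symmetric] by (simp add: col_eq_iff)
    note match = marked_columns_match[OF cnt i inj img same' V V1]
    obtain \<sigma> where \<sigma>: "\<sigma> permutes {..<n}" "\<forall>l<i. \<sigma> l = \<pi> l" "\<forall>l<n. col C1 \<phi> (\<sigma> l) = u l"
      using extend_injection_preserving_labels[OF i inj img, of "col C1 \<phi>" u] match by blast
    have "act \<sigma> c = \<phi> c" if "c \<in> C1" for c
      using \<sigma>(3) that C1[OF that] C2 \<phi>(1) \<sigma>(1) by (subst act_eq_iff) (auto simp: u_def col_eq_iff)
    then have "act \<sigma> ` C1 = C2" using \<phi>(1) by auto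
    then show "extendable n C1 C2 i \<pi>" using \<sigma> by (auto simp: extendable_def)
  next
    assume ext: "extendable n C1 C2 i \<pi>"
    then obtain \<sigma> where \<sigma>: "\<sigma> permutes {..<n}" "\<forall>l<i. \<sigma> l = \<pi> l" "act \<sigma> ` C1 = C2"
      by (auto simp: extendable_def)
    have col: "col C1 (act \<sigma>) (\<sigma> l) = u l" if "l < n" for l
      using act_nth[of \<sigma> _ l] C1 \<sigma>(1) that by (auto simp: u_def col_eq_iff)
    have V\<sigma>: "V (\<sigma> l) = mark u n i l" if "l < n" for l
    proof (cases "l < i")
      case False
      then have "\<sigma> l \<notin> \<pi> ` {..<i}"
        using \<sigma>(2) inj_eq[OF permutes_inj[OF \<sigma>(1)], of l] by (metis imageE lessThan_iff)
      then show ?thesis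
        using False V1[of "\<sigma> l"] permutes_in_image[OF \<sigma>(1), of l] that by (simp add: mark_def)
    qed (use V \<sigma>(2) in auto)
    have "image_mset u (mset (positions (mark u n i) n))
        = image_mset (col C1 (act \<sigma>)) (mset (positions V n))"
    proof (rule multiset_eqI)
      fix x
      show "count (image_mset u (mset (positions (mark u n i) n))) x
          = count (image_mset (col C1 (act \<sigma>)) (mset (positions V n))) x"
        unfolding count_image_positions
        by (subst sum.permute[OF \<sigma>(1)]) (auto intro!: sum.cong simp: col V\<sigma>)
    qed
    then show "perm_equivalent m (select (positions (mark u n i) n) ` C1)
        (select (positions V n) ` C2)"
      using iff \<sigma>(3) unfolding u_def by blast
  qed
qed

section \<open>A program logic with unit costs\<close>

definition bounded :: "nat \<Rightarrow> state \<Rightarrow> bool" where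
  "bounded L s \<longleftrightarrow> (\<forall>x. bits (reg s x) \<le> L \<and> bits (mem s x) \<le> L)"

text \<open>
  In \<open>T\<close> steps the length of the numbers grows by at most \<open>T\<close> bits, since addition is the only
  instruction that produces longer numbers. So a bound on the number of steps, with \<open>Const x a\<close>
  counted as \<open>a + 1\<close> steps, yields a bound on the logarithmic cost.
\<close>

definition runs :: "(nat list \<Rightarrow> bool) \<Rightarrow> prog \<Rightarrow> state \<Rightarrow> (nat \<Rightarrow> state \<Rightarrow> bool) \<Rightarrow> bool" where
  "runs Q P s R \<longleftrightarrow> (\<exists>t s' T. exec Q P s t s' \<and> R T s' \<and>
     (\<forall>L. bounded L s \<longrightarrow> bounded (L + T) s' \<and> t \<le> T * (3 + 2 * (L + T))))"

lemma runsI: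
  assumes "exec Q P s t s'" "R T s'"
    and "\<And>L. bounded L s \<Longrightarrow> bounded (L + T) s' \<and> t \<le> T * (3 + 2 * (L + T))"
  shows "runs Q P s R"
  using assms unfolding runs_def by blast

lemma runsE:
  assumes "runs Q P s R"
  obtains t s' T where "exec Q P s t s'" "R T s'"
    "\<And>L. bounded L s \<Longrightarrow> bounded (L + T) s' \<and> t \<le> T * (3 + 2 * (L + T))"
  using assms unfolding runs_def by blast

lemma runs_mono: "runs Q P s R \<Longrightarrow> (\<And>T s'. R T s' \<Longrightarrow> R' T s') \<Longrightarrow> runs Q P s R'"
  unfolding runs_def by blast

lemma runs_state_cong: "s = s' \<Longrightarrow> runs Q P s R \<longleftrightarrow> runs Q P s' R"
  by simp

lemma reg_set_reg [simp]: "reg (set_reg x a s) y = (if y = x then a else reg s y)"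
  by (simp add: set_reg_def)

lemma set_reg_simps [simp]:
  "mem (set_reg x a s) = mem s" "out (set_reg x a s) = out s"
  "qtape (set_reg x a s) = qtape s" "asked (set_reg x a s) = asked s"
  by (simp_all add: set_reg_def)

lemma bits_mono: "a \<le> b \<Longrightarrow> bits a \<le> bits b"
  by (rule floorlog_mono)

lemma bits_le_iff: "bits a \<le> L \<longleftrightarrow> a < 2 ^ L"
  by (simp add: floorlog_le_iff)

lemma bits_le_self: "bits a \<le> a"
  unfolding bits_le_iff by (rule less_exp)

lemma bits_add: "bits a \<le> L \<Longrightarrow> bits b \<le> L \<Longrightarrow> bits (a + b) \<le> Suc L"
  unfolding bits_le_iff by simp

lemma bounded_mono: "bounded L s \<Longrightarrow> L \<le> L' \<Longrightarrow> bounded L' s"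
  unfolding bounded_def by (meson order_trans)

lemma bounded_set_reg: "bounded L s \<Longrightarrow> bits a \<le> L \<Longrightarrow> bounded L (set_reg x a s)"
  by (simp add: bounded_def)

lemma bounded_reg: "bounded L s \<Longrightarrow> bits (reg s x) \<le> L"
  and bounded_mem: "bounded L s \<Longrightarrow> bits (mem s x) \<le> L"
  by (simp_all add: bounded_def)

lemma runs_Skip: "R 1 s \<Longrightarrow> runs Q Skip s R"
  by (erule runsI[OF exec.Skip]) (auto elim: bounded_mono)

lemma runs_Const: "R (Suc a) (set_reg x a s) \<Longrightarrow> runs Q (Const x a) s R"
  using bits_le_self[of a]
  by (elim runsI[OF exec.Const]) (auto elim!: bounded_mono intro!: bounded_set_reg)

lemma runs_Plus: "R 1 (set_reg x (reg s y + reg s z) s) \<Longrightarrow> runs Q (Plus x y z) s R"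
proof (erule runsI[OF exec.Plus], goal_cases)
  case (1 L)
  have "bits (reg s y) \<le> L" "bits (reg s z) \<le> L" using 1 by (auto intro: bounded_reg)
  then show ?case using 1 bits_add[of "reg s y" L "reg s z"]
    by (auto elim!: bounded_mono intro!: bounded_set_reg)
qed

lemma runs_Minus: "R 1 (set_reg x (reg s y - reg s z) s) \<Longrightarrow> runs Q (Minus x y z) s R"
proof (erule runsI[OF exec.Minus], goal_cases)
  case (1 L)
  have "bits (reg s y) \<le> L" "bits (reg s z) \<le> L" using 1 by (auto intro: bounded_reg)
  then show ?case using 1 bits_mono[of "reg s y - reg s z" "reg s y"]
    by (auto elim!: bounded_mono intro!: bounded_set_reg)
qed

lemma runs_Load: "R 1 (set_reg x (mem s (reg s y)) s) \<Longrightarrow> runs Q (Load x y) s R"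
proof (erule runsI[OF exec.Load], goal_cases)
  case (1 L)
  have "bits (reg s y) \<le> L" "bits (mem s (reg s y)) \<le> L"
    using 1 by (auto intro: bounded_reg bounded_mem)
  then show ?case using 1 by (auto elim!: bounded_mono intro!: bounded_set_reg)
qed

lemma runs_Store:
  "R 1 (s\<lparr>mem := (mem s)(reg s x := reg s y)\<rparr>) \<Longrightarrow> runs Q (Store x y) s R"
proof (erule runsI[OF exec.Store], goal_cases)
  case (1 L)
  have "bits (reg s x) \<le> L" "bits (reg s y) \<le> L" using 1 by (auto intro: bounded_reg)
  then have "1 + bits (reg s x) + bits (reg s y) \<le> 1 * (3 + 2 * (L + 1))" by simp
  then show ?case using 1 by (auto simp: bounded_def le_SucI)
qed

lemma runs_Write: "R 1 (s\<lparr>out := out s @ [reg s x]\<rparr>) \<Longrightarrow> runs Q (Write x) s R"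
proof (erule runsI[OF exec.Write], goal_cases)
  case (1 L)
  then have "1 + bits (reg s x) \<le> 1 * (3 + 2 * (L + 1))" using bounded_reg[of L s x] by simp
  then show ?case using 1 by (auto simp: bounded_def le_SucI)
qed

lemma runs_Put: "R 1 (s\<lparr>qtape := qtape s @ [reg s x]\<rparr>) \<Longrightarrow> runs Q (Put x) s R"
proof (erule runsI[OF exec.Put], goal_cases)
  case (1 L)
  then have "1 + bits (reg s x) \<le> 1 * (3 + 2 * (L + 1))" using bounded_reg[of L s x] by simp
  then show ?case using 1 by (auto simp: bounded_def le_SucI)
qed

lemma runs_Ask:
  "R 1 ((set_reg x (of_bool (Q (qtape s))) s)\<lparr>qtape := [], asked := asked s @ [qtape s]\<rparr>)
    \<Longrightarrow> runs Q (Ask x) s R"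
proof (erule runsI[OF exec.Ask], goal_cases)
  case (1 L)
  have "bits (of_bool b) \<le> Suc L" for b using bits_le_self[of "of_bool b"] by (cases b) auto
  then show ?case using 1 by (auto simp: bounded_def le_SucI)
qed

text \<open>The bound is superadditive in the number of steps, even though the second part starts
  with numbers of up to \<open>L + T1\<close> bits.\<close>

lemma cost_add:
  fixes T1 T2 L :: nat
  assumes "t1 \<le> T1 * (3 + 2 * (L + T1))" "t2 \<le> T2 * (3 + 2 * (L + T1 + T2))"
  shows "t1 + t2 \<le> (T1 + T2) * (3 + 2 * (L + (T1 + T2)))"
proof -
  have "T1 * (3 + 2 * (L + T1)) \<le> T1 * (3 + 2 * (L + (T1 + T2)))" by (intro mult_left_mono) auto
  then show ?thesis
    unfolding distrib_right using order_trans[OF assms(1)] assms(2)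
    by (intro add_mono) (simp_all only: add.assoc)
qed

text \<open>The quantifier over \<open>L\<close> inside \<open>runs\<close> pays off here: the
  second program is instantiated at \<open>L + T1\<close>, the size that the first one leaves
  behind.\<close>

lemma runs_Seq:
  assumes "runs Q P1 s (\<lambda>T1 s1. runs Q P2 s1 (\<lambda>T2. R (T1 + T2)))"
  shows "runs Q (Seq P1 P2) s R"
proof -
  obtain t1 s1 T1 where 1: "exec Q P1 s t1 s1" "runs Q P2 s1 (\<lambda>T2. R (T1 + T2))"
    "\<And>L. bounded L s \<Longrightarrow> bounded (L + T1) s1 \<and> t1 \<le> T1 * (3 + 2 * (L + T1))"
    using runsE[OF assms] by blast
  obtain t2 s2 T2 where 2: "exec Q P2 s1 t2 s2" "R (T1 + T2) s2"
    "\<And>L. bounded L s1 \<Longrightarrow> bounded (L + T2) s2 \<and> t2 \<le> T2 * (3 + 2 * (L + T2))"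
    using runsE[OF 1(2)] by blast
  have "bounded (L + (T1 + T2)) s2 \<and> t1 + t2 \<le> (T1 + T2) * (3 + 2 * (L + (T1 + T2)))"
    if L: "bounded L s" for L
    using 1(3)[OF L] 2(3)[of "L + T1"] cost_add[of t1 T1 L t2 T2] by (metis add.assoc)
  then show ?thesis by (rule runsI[where R = R, OF exec.Seq[OF 1(1) 2(1)] 2(2)])
qed

lemma cost_test:
  fixes T L b :: nat
  assumes "t \<le> T * (3 + 2 * (L + T))" "b \<le> L"
  shows "1 + b + t \<le> Suc T * (3 + 2 * (L + Suc T))"
proof -
  have "T * (3 + 2 * (L + T)) \<le> T * (3 + 2 * (L + Suc T))" by (intro mult_left_mono) auto
  then have "t \<le> T * (3 + 2 * (L + Suc T))" using assms(1) by (rule order_trans[rotated])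
  moreover have "1 + b \<le> 3 + 2 * (L + Suc T)" using assms(2) by simp
  ultimately show ?thesis unfolding mult_Suc by linarith
qed

lemma runs_Branch:
  assumes "reg s x \<noteq> 0 \<Longrightarrow> runs Q P1 s (\<lambda>T. R (Suc T))"
    and "reg s x = 0 \<Longrightarrow> runs Q P2 s (\<lambda>T. R (Suc T))"
  shows "runs Q (Branch x P1 P2) s R"
proof (cases "reg s x = 0")
  case True
  then obtain t s' T where 1: "exec Q P2 s t s'" "R (Suc T) s'"
    "\<And>L. bounded L s \<Longrightarrow> bounded (L + T) s' \<and> t \<le> T * (3 + 2 * (L + T))"
    using runsE[OF assms(2)] by blast
  have "bounded (L + Suc T) s' \<and> 1 + t \<le> Suc T * (3 + 2 * (L + Suc T))" if "bounded L s" for L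
    using 1(3)[OF that] cost_test[of t T L 0] by (auto intro: bounded_mono)
  then show ?thesis by (rule runsI[where R = R, OF exec.Branch_else[OF True 1(1)] 1(2)])
next
  case False
  then obtain t s' T where 1: "exec Q P1 s t s'" "R (Suc T) s'"
    "\<And>L. bounded L s \<Longrightarrow> bounded (L + T) s' \<and> t \<le> T * (3 + 2 * (L + T))"
    using runsE[OF assms(1)] by blast
  have "bounded (L + Suc T) s' \<and> 1 + bits (reg s x) + t \<le> Suc T * (3 + 2 * (L + Suc T))"
    if "bounded L s" for L
    using 1(3)[OF that] cost_test[OF _ bounded_reg[OF that]] by (auto intro: bounded_mono)
  then show ?thesis by (rule runsI[where R = R, OF exec.Branch_then[OF False 1(1)] 1(2)])
qed

lemma runs_Loop_end: "reg s x = 0 \<Longrightarrow> R 1 s \<Longrightarrow> runs Q (Loop x P) s R"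
  by (rule runsI[OF exec.Loop_end]) (auto elim: bounded_mono)

lemma runs_Loop_step:
  assumes "reg s x \<noteq> 0" "runs Q P s (\<lambda>T1 s1. runs Q (Loop x P) s1 (\<lambda>T2. R (Suc (T1 + T2))))"
  shows "runs Q (Loop x P) s R"
proof -
  obtain t1 s1 T1 where 1: "exec Q P s t1 s1"
    "runs Q (Loop x P) s1 (\<lambda>T2. R (Suc (T1 + T2)))"
    "\<And>L. bounded L s \<Longrightarrow> bounded (L + T1) s1 \<and> t1 \<le> T1 * (3 + 2 * (L + T1))"
    using runsE[OF assms(2)] by blast
  obtain t2 s2 T2 where 2: "exec Q (Loop x P) s1 t2 s2" "R (Suc (T1 + T2)) s2"
    "\<And>L. bounded L s1 \<Longrightarrow> bounded (L + T2) s2 \<and> t2 \<le> T2 * (3 + 2 * (L + T2))"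
    using runsE[OF 1(2)] by blast
  have "bounded (L + Suc (T1 + T2)) s2 \<and> 1 + bits (reg s x) + t1 + t2
      \<le> Suc (T1 + T2) * (3 + 2 * (L + Suc (T1 + T2)))" if L: "bounded L s" for L
  proof
    have *: "bounded (L + T1 + T2) s2" "t1 + t2 \<le> (T1 + T2) * (3 + 2 * (L + (T1 + T2)))"
      using 1(3)[OF L] 2(3)[of "L + T1"] cost_add[of t1 T1 L t2 T2] by blast+
    show "bounded (L + Suc (T1 + T2)) s2" using *(1) by (rule bounded_mono) simp
    show "1 + bits (reg s x) + t1 + t2 \<le> Suc (T1 + T2) * (3 + 2 * (L + Suc (T1 + T2)))"
      using cost_test[OF *(2) bounded_reg[OF L], of x] by simp
  qed
  then show ?thesis by (rule runsI[where R = R, OF exec.Loop_step[OF assms(1) 1(1) 2(1)] 2(2)])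
qed

lemmas runs_basic = runs_Skip runs_Const runs_Plus runs_Minus runs_Load runs_Store runs_Write
  runs_Put runs_Ask

notation Seq (infixr \<open>;;\<close> 60)

text \<open>Register \<open>0\<close> is reserved for the loop test, for which all loops can share one register.\<close>

definition For :: "nat \<Rightarrow> nat \<Rightarrow> prog \<Rightarrow> prog" where
  "For i x P = Const i 0 ;; Minus 0 x i ;; Loop 0 (P ;; Const 0 1 ;; Plus i i 0 ;; Minus 0 x i)"

text \<open>A round costs the body plus 5: one for the test, two for \<open>Const 0 1\<close>, two
  for the addition and subtraction. The final 3 are the two initial instructions and the last test.
  \<open>insensitive\<close> is there because the counter and the test register change between
  rounds.\<close>

lemma runs_For:
  assumes reg: "i \<noteq> 0" "x \<noteq> 0" "i \<noteq> x"
    and N: "reg s x = N"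
    and start: "I 0 s"
    and insensitive: "\<And>a s y z. I a s \<Longrightarrow> I a (set_reg 0 y (set_reg i z s))"
    and body: "\<And>a s. a < N \<Longrightarrow> I a s \<Longrightarrow> reg s i = a \<Longrightarrow> reg s x = N \<Longrightarrow>
      runs Q P s (\<lambda>T s'. T \<le> c \<and> reg s' i = a \<and> reg s' x = N \<and> I (Suc a) s')"
    and "end": "\<And>T s'. I N s' \<Longrightarrow> T \<le> N * (c + 5) + 3 \<Longrightarrow> R T s'"
  shows "runs Q (For i x P) s R"
proof -
  let ?P = "P ;; Const 0 1 ;; Plus i i 0 ;; Minus 0 x i"
  have loop: "runs Q (Loop 0 ?P) s R"
    if "a \<le> N" "I a s" "reg s i = a" "reg s x = N" "reg s 0 = N - a"
      "\<And>T s'. I N s' \<Longrightarrow> T \<le> (N - a) * (c + 5) + 1 \<Longrightarrow> R T s'" for a s R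
    using that
  \<comment> \<open>\<open>R\<close> is generalised because each round shifts the step count in the
    postcondition.\<close>
  proof (induction "N - a" arbitrary: a s R)
    case 0
    then show ?case by (intro runs_Loop_end) auto
  next
    case (Suc d)
    then have a: "a < N" by simp
    have d: "N - a = Suc (N - Suc a)" using a by simp
    show ?case
    proof (rule runs_Loop_step)
      show "runs Q ?P s (\<lambda>T1 s1. runs Q (Loop 0 ?P) s1 (\<lambda>T2. R (Suc (T1 + T2))))"
      proof (rule runs_Seq, rule runs_mono[OF body[OF a Suc.prems(2-4)]], elim conjE)
        fix T s' assume s': "T \<le> c" "reg s' i = a" "reg s' x = N" "I (Suc a) s'"
        have "set_reg 0 (N - Suc a) (set_reg i (Suc a) (set_reg 0 1 s'))
            = set_reg 0 (N - Suc a) (set_reg i (Suc a) s')"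
          using reg by (auto simp: set_reg_def)
        then have *: "I (Suc a) (set_reg 0 (N - Suc a) (set_reg i (Suc a) (set_reg 0 1 s')))"
          using insensitive[OF s'(4)] by simp
        show "runs Q (Const 0 1 ;; Plus i i 0 ;; Minus 0 x i) s'
            (\<lambda>T2 s1. runs Q (Loop 0 ?P) s1 (\<lambda>T3. R (Suc (T + T2 + T3))))"
        proof (intro runs_Seq runs_basic, goal_cases)
          case 1
          show ?case
            using reg s' a * Suc.hyps(2) d by (intro Suc.hyps(1)[of "Suc a"]) (auto intro!: Suc.prems(6))
        qed
      qed
    qed (use Suc.prems a in simp)
  qed
  have *: "I 0 (set_reg 0 N (set_reg i 0 s))" by (intro insensitive start)
  show ?thesis
    unfolding For_def
  proof (intro runs_Seq runs_basic, goal_cases)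
    case 1
    show ?case using reg N * by (intro loop[of 0]) (auto intro!: "end")
  qed
qed

definition same_regs :: "nat set \<Rightarrow> state \<Rightarrow> state \<Rightarrow> bool" where
  "same_regs X s s' \<longleftrightarrow> (\<forall>x. x \<notin> X \<longrightarrow> reg s' x = reg s x)"

lemma same_regsD: "same_regs X s s' \<Longrightarrow> x \<notin> X \<Longrightarrow> reg s' x = reg s x"
  by (simp add: same_regs_def)

lemma same_regs_refl [simp]: "same_regs X s s"
  by (simp add: same_regs_def)

lemma same_regs_set_reg [simp]:
  "x \<in> X \<Longrightarrow> same_regs X s (set_reg x a s') \<longleftrightarrow> same_regs X s s'"
  by (auto simp: same_regs_def)

lemma same_regs_record [simp]:
  "same_regs X s (s'\<lparr>mem := m\<rparr>) \<longleftrightarrow> same_regs X s s'"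
  "same_regs X s (s'\<lparr>out := o'\<rparr>) \<longleftrightarrow> same_regs X s s'"
  "same_regs X s (s'\<lparr>qtape := p\<rparr>) \<longleftrightarrow> same_regs X s s'"
  "same_regs X s (s'\<lparr>asked := p'\<rparr>) \<longleftrightarrow> same_regs X s s'"
  by (auto simp: same_regs_def)

text \<open>The query tape is left out so that \<open>put_matrix\<close> satisfies this too.\<close>

definition same_data :: "state \<Rightarrow> state \<Rightarrow> bool" where
  "same_data s s' \<longleftrightarrow> mem s' = mem s \<and> out s' = out s \<and> asked s' = asked s"

lemma same_data_simps [simp]:
  "same_data s s"
  "same_data s (set_reg x a s') \<longleftrightarrow> same_data s s'"
  "same_data s (s'\<lparr>qtape := p\<rparr>) \<longleftrightarrow> same_data s s'"
  by (auto simp: same_data_def)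

section \<open>The program\<close>

text \<open>
  Registers 0 to 9 hold temporary values. The memory contains the input, the partial permutation
  found so far (from \<open>rP\<close>), and the multiplicities of the columns of the first matrix (from \<open>rW\<close>)
  and of the second (from \<open>rV\<close>).
\<close>

abbreviation (input) "rq \<equiv> 10 :: nat"
abbreviation (input) "rk \<equiv> 11 :: nat"
abbreviation (input) "rn \<equiv> 12 :: nat"
abbreviation (input) "r1 \<equiv> 13 :: nat"
abbreviation (input) "rG \<equiv> 14 :: nat"
abbreviation (input) "rH \<equiv> 15 :: nat"
abbreviation (input) "rP \<equiv> 16 :: nat"
abbreviation (input) "rW \<equiv> 17 :: nat"
abbreviation (input) "rV \<equiv> 18 :: nat"
abbreviation (input) "ri \<equiv> 20 :: nat"
abbreviation (input) "rj \<equiv> 21 :: nat"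
abbreviation (input) "rl \<equiv> 22 :: nat"
abbreviation (input) "rmark \<equiv> 23 :: nat"
abbreviation (input) "rdone \<equiv> 24 :: nat"
abbreviation (input) "rok \<equiv> 25 :: nat"
abbreviation (input) "rw \<equiv> 26 :: nat"
abbreviation (input) "rd \<equiv> 27 :: nat"
abbreviation (input) "re \<equiv> 28 :: nat"
abbreviation (input) "rp \<equiv> 29 :: nat"
abbreviation (input) "rm \<equiv> 30 :: nat"
abbreviation (input) "rm' \<equiv> 31 :: nat"

text \<open>Equality is tested without a comparison instruction: the truncated differences in both
  directions add up to zero exactly for equal numbers. Adding \<open>rn\<close> to both pointers
  moves them down one row, which avoids multiplication.\<close>

definition differ :: "nat \<Rightarrow> nat \<Rightarrow> nat \<Rightarrow> nat \<Rightarrow> prog" where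
  "differ e base x y =
     Const e 0 ;; Plus 1 base x ;; Plus 2 base y ;;
     For 6 rk (Load 3 1 ;; Load 4 2 ;; Minus 5 3 4 ;; Minus 3 4 3 ;; Plus 5 5 3 ;;
       Branch 5 (Const e 1) Skip ;; Plus 1 1 rn ;; Plus 2 2 rn)"

definition require_equal :: "nat \<Rightarrow> nat \<Rightarrow> nat \<Rightarrow> prog" where
  "require_equal ok x y = Minus 1 x y ;; Minus 2 y x ;; Plus 1 1 2 ;; Branch 1 (Const ok 0) Skip"

definition require_unequal :: "nat \<Rightarrow> nat \<Rightarrow> nat \<Rightarrow> prog" where
  "require_unequal ok x y = Minus 1 x y ;; Minus 2 y x ;; Plus 1 1 2 ;; Branch 1 Skip (Const ok 0)"

text \<open>Setting a register to 0 and adding another to it replaces a move instruction.\<close>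

definition put_matrix :: "nat \<Rightarrow> nat \<Rightarrow> prog" where
  "put_matrix base weights =
     Const 1 0 ;; Plus 1 1 base ;;
     For 6 rk (Const 2 0 ;; Plus 2 2 weights ;;
       For 7 rn (Load 3 2 ;; Load 4 1 ;; For 8 3 (Put 4) ;; Plus 1 1 r1 ;; Plus 2 2 r1))"

text \<open>
  The answer is in \<open>rok\<close>. Register \<open>rw\<close> receives the multiplicity to be given to column \<open>i\<close>, which
  is 1 if that column repeats an earlier one.
\<close>

definition compare :: prog where
  "compare = Const rok 1 ;; Const rw 0 ;; Plus rw rw rmark ;;
     For rl ri (Plus 9 rP rl ;; Load rp 9 ;; differ rd rG rl ri ;; differ re rH rp rj ;;
       require_unequal rok rp rj ;; require_equal rok rd re ;;
       Branch rd Skip (Const rw 1))"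

text \<open>Multiplicities are written tentatively. Registers 9 and \<open>rp\<close> survive the
  construction of the query, so a negative answer can reset both cells to 1, their previous value.
  The length grows by \<open>rw - 1\<close> because one copy was already counted.\<close>

definition attempt :: prog where
  "attempt = Plus 9 rW ri ;; Store 9 rw ;; Plus rp rV rj ;; Store rp rw ;;
     Plus rm' rm rw ;; Minus rm' rm' r1 ;; Put rq ;; Put rk ;; Put rm' ;;
     put_matrix rG rW ;; put_matrix rH rV ;; Ask 1 ;;
     Branch 1 (Plus 9 rP ri ;; Store 9 rj ;; Const rdone 1 ;; Const rm 0 ;; Plus rm rm rm')
       (Store 9 r1 ;; Store rp r1)"

text \<open>\<open>rmark\<close> runs through the multiples of \<open>n\<close> by addition. A
  \<open>For\<close> loop cannot be left early; \<open>rdone\<close> makes the remaining candidates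
  idle.\<close>

definition search :: prog where
  "search = For ri rn (Plus rmark rmark rn ;; Const rdone 0 ;;
     For rj rn (Branch rdone Skip (compare ;; Branch rok attempt Skip)))"

definition setup_regs :: prog where
  "setup_regs = Const 1 0 ;; Load rq 1 ;; Const r1 1 ;; Load rk r1 ;; Const 1 2 ;; Load rn 1 ;;
     Const rG 3 ;; Const rH 3 ;; For 6 rk (Plus rH rH rn) ;;
     Const rP 0 ;; Plus rP rP rH ;; For 6 rk (Plus rP rP rn) ;;
     Plus rW rP rn ;; Plus rV rW rn ;; Const rm 0 ;; Plus rm rm rn"

definition setup_mem :: prog where
  "setup_mem = For 6 rn (Plus 1 rW 6 ;; Store 1 r1 ;; Plus 1 rV 6 ;; Store 1 r1)"

definition write_permutation :: prog where
  "write_permutation = For 6 rn (Plus 1 rP 6 ;; Load 2 1 ;; Write 2)"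

definition find_permutation :: prog where
  "find_permutation = setup_regs ;; setup_mem ;; search ;; write_permutation"

section \<open>Behaviour and cost of the subprograms\<close>

lemma runs_differ:
  fixes e base x y :: nat and s :: state
  assumes "6 < e" "6 < base" "6 < x" "6 < y" "e \<notin> {base, x, y, rk, rn}"
    and n: "reg s rn = n" and k: "reg s rk = k"
    and R: "\<And>T s'. same_regs ({0..6} \<union> {e}) s s' \<Longrightarrow> same_data s s' \<Longrightarrow> qtape s' = qtape s \<Longrightarrow>
      reg s' e = of_bool (\<exists>r<k. mem s (reg s base + r * n + reg s x) \<noteq>
        mem s (reg s base + r * n + reg s y)) \<Longrightarrow> T \<le> k * 16 + 6 \<Longrightarrow> R T s'"
  shows "runs Q (differ e base x y) s R"
proof -
  let ?p = "\<lambda>r. reg s base + r * n + reg s x" and ?p' = "\<lambda>r. reg s base + r * n + reg s y"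
  define I where "I r s' \<longleftrightarrow> same_regs ({0..6} \<union> {e}) s s' \<and> same_data s s' \<and>
    qtape s' = qtape s \<and> reg s' 1 = ?p r \<and> reg s' 2 = ?p' r \<and>
    reg s' e = of_bool (\<exists>r'<r. mem s (?p r') \<noteq> mem s (?p' r'))" for r and s' :: state
  show ?thesis
    unfolding differ_def
  proof (intro runs_Seq runs_basic, rule runs_For[where N = k and I = I and c = 11], goal_cases)
    case (7 a s')
    then have "reg s' 12 = n" "mem s' = mem s" using n assms(5) same_regsD[of _ s s' 12]
      by (auto simp: I_def same_data_def)
    then show ?case
      using 7 assms(1-5)
      by - ((rule runs_Seq, rule runs_basic, (simp add: I_def cong: runs_state_cong)?)+,
        intro runs_Seq runs_Branch runs_basic, auto simp: I_def less_Suc_eq)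
  next
    case (8 T s')
    then show ?case using assms(1-5) by (intro R) (auto simp: I_def)
  qed (use assms in \<open>auto simp: I_def\<close>)
qed

lemma runs_require_equal:
  assumes "x \<notin> {1, 2}" "y \<notin> {1, 2}" "ok \<notin> {1, 2}"
    and R: "\<And>T s'. same_regs {1, 2, ok} s s' \<Longrightarrow> same_data s s' \<Longrightarrow> qtape s' = qtape s \<Longrightarrow>
      reg s' ok = (if reg s x = reg s y then reg s ok else 0) \<Longrightarrow> T \<le> 5 \<Longrightarrow> R T s'"
  shows "runs Q (require_equal ok x y) s R"
  unfolding require_equal_def using assms(1-3)
  by (intro runs_Seq runs_basic runs_Branch R) auto

lemma runs_require_unequal:
  assumes "x \<notin> {1, 2}" "y \<notin> {1, 2}" "ok \<notin> {1, 2}"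
    and R: "\<And>T s'. same_regs {1, 2, ok} s s' \<Longrightarrow> same_data s s' \<Longrightarrow> qtape s' = qtape s \<Longrightarrow>
      reg s' ok = (if reg s x \<noteq> reg s y then reg s ok else 0) \<Longrightarrow> T \<le> 5 \<Longrightarrow> R T s'"
  shows "runs Q (require_unequal ok x y) s R"
  unfolding require_unequal_def using assms(1-3)
  by (intro runs_Seq runs_basic runs_Branch R) auto

text \<open>The number of \<open>Put\<close> steps depends on the memory, so the time bound needs a
  bound \<open>w\<close> on the multiplicities; \<open>n * n\<close> will serve.\<close>

lemma runs_put_matrix:
  fixes base weights :: nat and s :: state
  assumes "8 < base" "8 < weights"
    and n: "reg s rn = n" and k: "reg s rk = k" and one: "reg s r1 = 1"
    and W: "\<And>l. l < n \<Longrightarrow> mem s (reg s weights + l) \<le> w"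
    and R: "\<And>T s'. same_regs {0..8} s s' \<Longrightarrow> same_data s s' \<Longrightarrow>
      qtape s' = qtape s @ concat (map (\<lambda>r. concat (map (\<lambda>l.
        replicate (mem s (reg s weights + l)) (mem s (reg s base + r * n + l))) [0..<n])) [0..<k])
      \<Longrightarrow> T \<le> k * (n * (w * 6 + 12) + 10) + 5 \<Longrightarrow> R T s'"
  shows "runs Q (put_matrix base weights) s R"
proof -
  let ?cell = "\<lambda>r l. replicate (mem s (reg s weights + l)) (mem s (reg s base + r * n + l))"
  let ?row = "\<lambda>r l. concat (map (?cell r) [0..<l])"
  \<comment> \<open>One invariant serves both loops: \<open>r\<close> complete rows followed by
    \<open>l\<close> cells of the next. A finished row, \<open>l = n\<close>, is the state described
    by \<open>I (Suc r) 0\<close>.\<close>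
  define I where "I r l s' \<longleftrightarrow> same_regs {0..8} s s' \<and> same_data s s' \<and>
    qtape s' = qtape s @ concat (map (\<lambda>r. ?row r n) [0..<r]) @ ?row r l \<and>
    reg s' 1 = reg s base + r * n + l" for r l and s' :: state
  have I_regs: "reg s' 12 = n" "reg s' 11 = k" "reg s' 13 = 1" "reg s' base = reg s base"
    "reg s' weights = reg s weights" "mem s' = mem s" if "I r l s'" for r l s'
    using that assms(1-5) by (auto simp: I_def same_data_def same_regs_def)
  show ?thesis
    unfolding put_matrix_def
  proof (intro runs_Seq runs_basic, rule runs_For[where N = k and I = "\<lambda>r. I r 0"
        and c = "n * (w * 6 + 12) + 5"], goal_cases)
    case (7 r s1)
    show ?case
    proof (intro runs_Seq runs_basic, rule runs_For[where N = n and c = "w * 6 + 7"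
          and I = "\<lambda>l s'. I r l s' \<and> reg s' 2 = reg s weights + l \<and> reg s' 6 = r"], goal_cases)
      case (7 l s2)
      let ?c = "mem s (reg s weights + l)"
      note regs = I_regs[OF conjunct1[OF 7(2)]]
      let ?s = "set_reg 4 (mem s (reg s base + r * n + l)) (set_reg 3 ?c s2)"
      have s3: "runs Q (For 8 3 (Put 4)) ?s R'"
        if R': "\<And>T s'. same_regs {0, 8} ?s s' \<Longrightarrow> same_data s s' \<Longrightarrow>
          qtape s' = qtape s2 @ ?cell r l \<Longrightarrow> T \<le> w * 6 + 3 \<Longrightarrow> R' T s'" for R'
      proof (rule runs_For[where N = ?c and c = 1 and I = "\<lambda>c s'. same_regs {0, 8} ?s s' \<and>
            same_data s s' \<and> qtape s' = qtape s2 @ replicate c (mem s (reg s base + r * n + l))"],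
          goal_cases)
        case (7 c s')
        then have "reg s' 4 = mem s (reg s base + r * n + l)" by (simp add: same_regs_def)
        then show ?case using 7
          by (intro runs_basic) (auto simp flip: replicate_append_same)
      next
        case (8 T s')
        moreover have "?c * 6 \<le> w * 6" using W[OF 7(1)] by simp
        ultimately show ?case by (intro R') auto
      qed (use 7 in \<open>auto simp: I_def\<close>)
      have eq: "mem s2 (reg s2 2) = ?c" "mem s2 (reg s2 1) = mem s (reg s base + r * n + l)"
        using 7 regs by (auto simp: I_def)
      show ?case
      proof (intro runs_Seq runs_basic, simp add: eq del: One_nat_def, rule s3, goal_cases)
        case (1 T s3)
        have "reg s3 x = reg s2 x" if "x \<notin> {0, 3, 4, 8}" for x
          using 1(1) that by (auto simp: same_regs_def)
        then have "same_regs {0..8} s s3" "reg s3 1 = reg s2 1" "reg s3 2 = reg s2 2"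
          "reg s3 6 = r" "reg s3 7 = l" "reg s3 12 = n" "reg s3 13 = 1"
          using 7 regs by (auto simp: I_def same_regs_def)
        then show ?case using 1 7 by (intro runs_Seq runs_basic) (auto simp: I_def)
      qed
    next
      case (8 T s')
      then show ?case using I_regs(1,2)[of r n s'] assms(1,2) by (auto simp: I_def algebra_simps)
    qed (use 7 I_regs[OF 7(2)] assms(1,2) in \<open>auto simp: I_def\<close>)
  next
    case (8 T s')
    then show ?case by (intro R) (auto simp: I_def algebra_simps)
  qed (use assms in \<open>auto simp: I_def\<close>)
qed

section \<open>The search on a fixed instance\<close>

text \<open>The tail \<open>ys\<close> allows the first matrix to be read in front of the
  second.\<close>

lemma nth_concat_rows:
  assumes "\<And>x. x \<in> set xs \<Longrightarrow> length x = n" "r < length xs" "l < n"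
  shows "(concat xs @ ys) ! (r * n + l) = xs ! r ! l"
  using assms
proof (induction xs arbitrary: r)
  case (Cons x xs)
  then show ?case by (cases r) (auto simp: nth_append add.assoc)
qed simp

lemma length_concat_rows:
  "(\<And>x. x \<in> set xs \<Longrightarrow> length x = n) \<Longrightarrow> length (concat xs) = length xs * n"
  by (induction xs) auto

text \<open>Generic over semirings so that one expression serves as a number in the cost analysis
  and as a polynomial in the theorem. The summands belong to \<open>compare\<close> and to the two
  matrices, with multiplicities at most x^2.\<close>

definition attempt_cost :: "'a::comm_semiring_1 \<Rightarrow> 'a" where
  "attempt_cost x = x * (x * 32 + 40) + 2 * (x * (x * (x * x * 6 + 12) + 10)) + 60"

lemma attempt_cost_mono:
  fixes n k x :: nat
  assumes "n \<le> x" "k \<le> x"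
  shows "n * (k * 32 + 40) + 10 + (2 * (k * (n * (n * n * 6 + 12) + 10)) + 40) + 10 \<le> attempt_cost x"
proof -
  have "n * (k * 32 + 40) \<le> x * (x * 32 + 40)" using assms by (intro mult_le_mono add_le_mono) auto
  moreover have "k * (n * (n * n * 6 + 12) + 10) \<le> x * (x * (x * x * 6 + 12) + 10)"
    using assms by (intro mult_le_mono add_le_mono) auto
  ultimately show ?thesis by (simp add: attempt_cost_def)
qed

lemma runs_add_multiple:
  assumes "x \<notin> {0, 6, rk, rn}"
    and R: "\<And>T s'. same_regs {0, 6, x} s s' \<Longrightarrow> same_data s s' \<Longrightarrow> qtape s' = qtape s \<Longrightarrow>
      reg s' x = reg s x + reg s rk * reg s rn \<Longrightarrow> T \<le> reg s rk * 6 + 3 \<Longrightarrow> R T s'"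
  shows "runs Q (For 6 rk (Plus x x rn)) s R"
proof (rule runs_For[where N = "reg s rk" and c = 1 and I = "\<lambda>a s'. same_regs {0, 6, x} s s' \<and>
      same_data s s' \<and> qtape s' = qtape s \<and> reg s' x = reg s x + a * reg s rn"], goal_cases)
  case (7 a s')
  then have "reg s' rn = reg s rn" using assms(1) same_regsD[of "{0, 6, x}" s s' rn] by auto
  then show ?case using 7 assms(1) by (intro runs_basic) auto
next
  case (8 T s')
  then show ?case by (intro R) auto
qed (use assms(1) in auto)

definition total_cost :: "'a::comm_semiring_1 \<Rightarrow> 'a" where
  "total_cost x = x * (x * (attempt_cost x + 5) + 20) + x * 29 + 100"

locale pce_pair =
  fixes F :: "nat ring" and q n k :: nat and Q G H C1 C2
  assumes field: "field F" and decides: "PCE_oracle F q Q"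
    and lin: "linear_code F n k C1" "linear_code F n k C2"
    and gen: "generator_matrix F n k G C1" "generator_matrix F n k H C2"
begin

abbreviation "u \<equiv> col C1 id"
abbreviation "v \<equiv> col C2 id"

definition valid_query :: "nat list \<Rightarrow> bool" where
  "valid_query w \<longleftrightarrow> (\<exists>m A B D1 D2. w = encode q k m A B \<and> PCE_instance F m k A B D1 D2 \<and>
     m \<le> n\<^sup>2 * (n + 1) div 2)"

lemma length_word: "c \<in> C1 \<Longrightarrow> length c = n" "c \<in> C2 \<Longrightarrow> length c = n"
  using lin submodule.subset
  by (fastforce simp: linear_code_def VectorSpace.subspace_def)+

lemma rows: "length G = k" "length H = k" "g \<in> set G \<Longrightarrow> length g = n"
  "h \<in> set H \<Longrightarrow> length h = n"
  using gen by (auto simp: generator_matrix_def)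

lemma u_eq_iff: "l < n \<Longrightarrow> l' < n \<Longrightarrow> u l = u l' \<longleftrightarrow> (\<forall>r<k. G ! r ! l = G ! r ! l')"
  using columns_agree_iff[OF field _ _ gen(1)] by (simp add: col_eq_iff)

lemma v_eq_iff: "l < n \<Longrightarrow> l' < n \<Longrightarrow> v l = v l' \<longleftrightarrow> (\<forall>r<k. H ! r ! l = H ! r ! l')"
  using columns_agree_iff[OF field _ _ gen(2)] by (simp add: col_eq_iff)

definition marks :: "nat \<Rightarrow> (nat \<Rightarrow> nat) \<Rightarrow> (nat \<Rightarrow> nat) \<Rightarrow> bool" where
  "marks i \<pi> V \<longleftrightarrow> (\<forall>l<i. V (\<pi> l) = mark u n i l) \<and> (\<forall>j<n. j \<notin> \<pi> ` {..<i} \<longrightarrow> V j = 1)"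

definition query :: "nat \<Rightarrow> (nat \<Rightarrow> nat) \<Rightarrow> nat list" where
  "query i V = encode q k (\<Sum>l<n. mark u n i l)
     (map (select (positions (mark u n i) n)) G) (map (select (positions V n)) H)"

text \<open>Both matrices of a query need a common length. The marks on the second side are those of
  the first moved along an injection, and every remaining column counts 1 on either side.\<close>

lemma sum_marks:
  assumes "i \<le> n" "inj_on \<pi> {..<i}" "\<pi> ` {..<i} \<subseteq> {..<n}" "marks i \<pi> V"
  shows "(\<Sum>j<n. V j) = (\<Sum>l<n. mark u n i l)"
proof -
  have "(\<Sum>j<n. V j) = (\<Sum>j\<in>{..<n} - \<pi> ` {..<i}. V j) + (\<Sum>j\<in>\<pi> ` {..<i}. V j)"
    by (rule sum.subset_diff) (use assms in auto)
  also have "(\<Sum>j\<in>{..<n} - \<pi> ` {..<i}. V j) = n - i"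
    using assms(3,4) by (simp add: marks_def card_Diff_subset card_image[OF assms(2)])
  also have "(\<Sum>j\<in>\<pi> ` {..<i}. V j) = (\<Sum>l<i. mark u n i l)"
    using assms(4) by (simp add: sum.reindex[OF assms(2)] marks_def)
  also have "n - i = (\<Sum>l\<in>{..<n} - {..<i}. mark u n i l)"
    using assms(1) by (simp add: mark_def card_Diff_subset)
  also have "\<dots> + (\<Sum>l<i. mark u n i l) = (\<Sum>l<n. mark u n i l)"
    by (rule sum.subset_diff[symmetric]) (use assms in auto)
  finally show ?thesis .
qed

lemma query_correct:
  assumes i: "i \<le> n" and inj: "inj_on \<pi> {..<i}" and img: "\<pi> ` {..<i} \<subseteq> {..<n}"
    and same: "\<And>l l'. l < i \<Longrightarrow> l' < i \<Longrightarrow> u l = u l' \<longleftrightarrow> v (\<pi> l) = v (\<pi> l')"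
    and V: "marks i \<pi> V"
  shows "valid_query (query i V)" "Q (query i V) \<longleftrightarrow> extendable n C1 C2 i \<pi>"
proof -
  let ?m = "\<Sum>l<n. mark u n i l" and ?ps = "positions (mark u n i) n" and ?qs = "positions V n"
  have len: "length ?ps = ?m" "length ?qs = ?m"
    using sum_marks[OF i inj img V] by (simp_all add: length_positions)
  have V1: "V (\<pi> l) = mark u n i l" if "l < i" for l using V that by (auto simp: marks_def)
  have V2: "V j = 1" if "j < n" "j \<notin> \<pi> ` {..<i}" for j using V that by (auto simp: marks_def)
  have "V j > 0" if "j < n" for j
  proof (cases "j \<in> \<pi> ` {..<i}")
    case True
    then obtain l where "l < i" "j = \<pi> l" by auto
    then show ?thesis using V1 i mark_pos[of l n u i] by simp
  qed (use V2 that in simp)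
  then have set: "set ?ps = {..<n}" "set ?qs = {..<n}"
    using mark_pos[of _ n u i] by (simp_all add: set_positions)
  have inst: "PCE_instance F ?m k (map (select ?ps) G) (map (select ?qs) H)
      (select ?ps ` C1) (select ?qs ` C2)"
    using select_instance[OF field set(1) lin(1) gen(1)]
      select_instance[OF field set(2) lin(2) gen(2)]
    unfolding PCE_instance_def len by blast
  then show "valid_query (query i V)"
    unfolding valid_query_def query_def using sum_mark_le[of u n i] by blast
  have "Q (query i V) \<longleftrightarrow> perm_equivalent ?m (select ?ps ` C1) (select ?qs ` C2)"
    using decides inst unfolding PCE_oracle_def query_def by blast
  also have "\<dots> \<longleftrightarrow> extendable n C1 C2 i \<pi>"
    using perm_equivalent_marked_iff[OF length_word i inj img same V1 V2 len] by blast
  finally show "Q (query i V) \<longleftrightarrow> extendable n C1 C2 i \<pi>" .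
qed

text \<open>A necessary condition that can be read off the two given matrices, and at the same time
  what secures the hypotheses of \<open>query_correct\<close> for the longer prefix.\<close>

definition compatible :: "nat \<Rightarrow> (nat \<Rightarrow> nat) \<Rightarrow> nat \<Rightarrow> bool" where
  "compatible i \<pi> j \<longleftrightarrow> (\<forall>l<i. \<pi> l \<noteq> j \<and> (u l = u i \<longleftrightarrow> v (\<pi> l) = v j))"

text \<open>Justifies rejecting a candidate without asking the oracle.\<close>

lemma extendable_compatible:
  assumes "extendable n C1 C2 (Suc i) (\<pi>(i := j))" "i < n"
  shows "compatible i \<pi> j"
proof -
  have "inj_on (\<pi>(i := j)) {..<Suc i}" using extendable_inj[OF assms(1)] assms(2) by simp
  then have "\<pi> l \<noteq> j" if "l < i" for l using that by (auto dest!: inj_onD[of _ _ l i])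
  moreover have "u l = u i \<longleftrightarrow> v (\<pi> l) = v j" if "l < i" for l
    using extendable_same_col[OF assms(1) length_word(1), of l i] that assms(2) by simp
  ultimately show ?thesis by (simp add: compatible_def)
qed

lemma marks_Suc:
  assumes "marks i \<pi> V" "compatible i \<pi> j" "i < n"
  shows "marks (Suc i) (\<pi>(i := j)) (V(j := mark u n (Suc i) i))"
  unfolding marks_def
proof (intro conjI allI impI)
  fix l assume "l < Suc i"
  then show "(V(j := mark u n (Suc i) i)) ((\<pi>(i := j)) l) = mark u n (Suc i) l"
    using assms by (auto simp: marks_def compatible_def mark_def less_Suc_eq)
next
  fix j' assume "j' < n" "j' \<notin> (\<pi>(i := j)) ` {..<Suc i}"
  then show "(V(j := mark u n (Suc i) i)) j' = 1"
    using assms by (auto simp: marks_def lessThan_Suc)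
qed

lemma query_Suc_correct:
  assumes ext: "extendable n C1 C2 i \<pi>" and V: "marks i \<pi> V" and comp: "compatible i \<pi> j"
    and "i < n" "j < n"
  defines "V' \<equiv> V(j := mark u n (Suc i) i)"
  shows "valid_query (query (Suc i) V')"
    "Q (query (Suc i) V') \<longleftrightarrow> extendable n C1 C2 (Suc i) (\<pi>(i := j))"
proof -
  have V': "marks (Suc i) (\<pi>(i := j)) V'" unfolding V'_def by (rule marks_Suc) fact+
  have inj: "inj_on \<pi> {..<i}" "\<pi> ` {..<i} \<subseteq> {..<n}"
    using extendable_inj[OF ext] assms(4) by auto
  have inj': "inj_on (\<pi>(i := j)) {..<Suc i}"
    using inj(1) comp by (auto simp: lessThan_Suc compatible_def inj_on_fun_updI inj_on_def)
  have img': "(\<pi>(i := j)) ` {..<Suc i} \<subseteq> {..<n}"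
    using inj(2) assms(5) by (auto simp: lessThan_Suc)
  have same: "u l = u l' \<longleftrightarrow> v ((\<pi>(i := j)) l) = v ((\<pi>(i := j)) l')"
    if ll: "l < Suc i" "l' < Suc i" for l l'
  proof -
    consider "l < i" "l' < i" | "l < i" "l' = i" | "l = i" "l' < i" | "l = i" "l' = i"
      using ll by linarith
    then show ?thesis
    proof cases
      case 1
      then show ?thesis using extendable_same_col[OF ext length_word(1), of l l'] assms(4) by simp
    qed (use comp in \<open>auto simp: compatible_def\<close>)
  qed
  show "valid_query (query (Suc i) V')"
    "Q (query (Suc i) V') \<longleftrightarrow> extendable n C1 C2 (Suc i) (\<pi>(i := j))"
    using query_correct[OF _ inj' img' same V'] assms(4) by auto
qed

text \<open>Links the mathematical query to what the nested loops write; \<open>f\<close> and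
  \<open>g\<close> stand for the memory cells holding multiplicities and entries.\<close>

lemma concat_select_cells:
  assumes "length A = k" "\<And>a. a \<in> set A \<Longrightarrow> length a = n"
    and "\<And>l. l < n \<Longrightarrow> f l = W l" "\<And>r l. r < k \<Longrightarrow> l < n \<Longrightarrow> g r l = A ! r ! l"
  shows "concat (map (select (positions W n)) A)
    = concat (map (\<lambda>r. concat (map (\<lambda>l. replicate (f l) (g r l)) [0..<n])) [0..<k])"
proof -
  have "select (positions W n) (A ! r) = concat (map (\<lambda>l. replicate (f l) (g r l)) [0..<n])"
    if "r < k" for r
    using assms(3,4) that
    by (auto simp: select_def positions_def map_concat comp_def intro!: arg_cong[where f = concat])
  then have "map (select (positions W n)) A
      = map (\<lambda>r. concat (map (\<lambda>l. replicate (f l) (g r l)) [0..<n])) [0..<k]"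
    using assms(1) by (intro nth_equalityI) auto
  then show ?thesis by simp
qed

section \<open>Running the search\<close>

text \<open>The offset 3 skips the header \<open>q\<close>, \<open>k\<close>, \<open>n\<close> of
  the input word; each product is one matrix.\<close>

definition aP :: nat where "aP = 3 + k * n + k * n"
definition aW :: nat where "aW = aP + n"
definition aV :: nat where "aV = aW + n"

definition ready :: "state \<Rightarrow> bool" where
  "ready s \<longleftrightarrow> reg s rq = q \<and> reg s rk = k \<and> reg s rn = n \<and> reg s r1 = 1 \<and> reg s rG = 3 \<and>
     reg s rH = 3 + k * n \<and> reg s rP = aP \<and> reg s rW = aW \<and> reg s rV = aV \<and>
     (\<forall>r<k. \<forall>l<n. mem s (3 + r * n + l) = G ! r ! l \<and> mem s (3 + k * n + r * n + l) = H ! r ! l)"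

definition perm_of :: "state \<Rightarrow> nat \<Rightarrow> nat" where "perm_of s l = mem s (aP + l)"
definition marks_of :: "state \<Rightarrow> nat \<Rightarrow> nat" where "marks_of s j = mem s (aV + j)"

definition matched :: "nat \<Rightarrow> state \<Rightarrow> bool" where
  "matched i s \<longleftrightarrow> ready s \<and> extendable n C1 C2 i (perm_of s) \<and> marks i (perm_of s) (marks_of s) \<and>
     (\<forall>l<n. mem s (aW + l) = mark u n i l) \<and> reg s rm = (\<Sum>l<n. mark u n i l) \<and>
     out s = [] \<and> qtape s = [] \<and> (\<forall>w\<in>set (asked s). valid_query w)"

text \<open>Keeps the two matrices apart in memory, and both apart from everything stored from
  \<open>aP\<close> on.\<close>

lemma cell_less: "r < k \<Longrightarrow> l < n \<Longrightarrow> r * n + l < k * n"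
proof -
  assume "r < k" "l < n"
  then have "r * n + l < Suc r * n" "Suc r * n \<le> k * n" by (simp_all only: mult_le_mono1 Suc_leI) simp
  then show ?thesis by linarith
qed

lemma runs_compare:
  assumes s: "matched i s" "i < n" "j < n" "reg s ri = i" "reg s rj = j" "reg s rmark = n * (i + 1)"
    and R: "\<And>T s'. same_regs ({0..9} \<union> {rl, rok, rw, rd, re, rp}) s s' \<Longrightarrow> same_data s s' \<Longrightarrow>
      qtape s' = qtape s \<Longrightarrow> reg s' rok = of_bool (compatible i (perm_of s) j) \<Longrightarrow>
      reg s' rw = mark u n (Suc i) i \<Longrightarrow> T \<le> n * (k * 32 + 40) + 10 \<Longrightarrow> R T s'"
  shows "runs Q' compare s R"
proof -
  let ?X = "{0..9} \<union> {rl, rok, rw, rd, re, rp}" and ?\<pi> = "perm_of s"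
  have \<pi>: "?\<pi> l < n" if "l < i" for l
    using extendable_inj(2)[of n C1 C2 i ?\<pi>] s(1,2) that by (auto simp: matched_def)
  define ok where "ok a \<longleftrightarrow> (\<forall>l<a. ?\<pi> l \<noteq> j \<and> (u l = u i \<longleftrightarrow> v (?\<pi> l) = v j))" for a
  \<comment> \<open>Its negation at \<open>a = i\<close> is freshness of column \<open>i\<close>,
    which decides between the mark and 1.\<close>
  define dup where "dup a \<longleftrightarrow> (\<exists>l<a. u l = u i)" for a
  have ok_Suc: "ok (Suc a) \<longleftrightarrow> ok a \<and> ?\<pi> a \<noteq> j \<and> (u a = u i \<longleftrightarrow> v (?\<pi> a) = v j)"
    and dup_Suc: "dup (Suc a) \<longleftrightarrow> dup a \<or> u a = u i" for a
    by (auto simp: ok_def dup_def less_Suc_eq)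
  have ok0: "ok 0" "\<not> dup 0" by (simp_all add: ok_def dup_def)
  define I where "I a s' \<longleftrightarrow> same_regs ?X s s' \<and> same_data s s' \<and> qtape s' = qtape s \<and>
    reg s' rok = of_bool (ok a) \<and> reg s' rw = (if dup a then 1 else n * (i + 1))" for a and s' :: state
  have I_regs: "reg s' rk = k" "reg s' rn = n" "reg s' rG = 3" "reg s' rH = 3 + k * n"
    "reg s' rP = aP" "reg s' ri = i" "reg s' rj = j"
    if "same_regs ?X s s'" for s'
    using that s by (auto simp: matched_def ready_def same_regs_def)
  show ?thesis
    unfolding compare_def
  proof (intro runs_Seq runs_basic, rule runs_For[where N = i and I = I and c = "k * 32 + 32"],
      goal_cases)
    case (7 l s1)
    then have l: "l < n" and s1: "same_regs ?X s s1" "mem s1 = mem s" using s(2)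
      by (auto simp: I_def same_data_def)
    note regs = I_regs[OF s1(1)]
    \<comment> \<open>By \<open>u_eq_iff\<close>, comparing the \<open>k\<close> rows of
      \<open>G\<close> decides equality of the columns over all codewords.\<close>
    have G: "(\<exists>r<k. mem s (3 + r * n + l) \<noteq> mem s (3 + r * n + i)) \<longleftrightarrow> u l \<noteq> u i"
      using s(1,2) l by (auto simp: u_eq_iff matched_def ready_def)
    have H: "(\<exists>r<k. mem s (3 + k * n + r * n + ?\<pi> l) \<noteq> mem s (3 + k * n + r * n + j)) \<longleftrightarrow>
        v (?\<pi> l) \<noteq> v j"
      using s(1,3) \<pi>[OF 7(1)] by (auto simp: v_eq_iff matched_def ready_def)
    show ?case
    proof (intro runs_Seq runs_basic, rule runs_differ[where n = n and k = k], goal_cases)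
      case (8 T1 s2)
      have s2: "same_regs ?X s s2" "mem s2 = mem s" "reg s2 rp = ?\<pi> l" "reg s2 rl = l"
        "reg s2 rd = of_bool (u l \<noteq> u i)" "reg s2 rok = reg s1 rok" "reg s2 rw = reg s1 rw"
        using 8 7(3) s1 regs G by (auto simp: same_regs_def same_data_def perm_of_def)
      note regs2 = I_regs[OF s2(1)]
      show ?case
      proof (rule runs_Seq, rule runs_differ[where n = n and k = k], goal_cases)
        case (8 T2 s3)
        have s3: "same_regs ?X s s3" "mem s3 = mem s" "reg s3 rp = ?\<pi> l" "reg s3 rl = l"
          "reg s3 rd = of_bool (u l \<noteq> u i)" "reg s3 re = of_bool (v (?\<pi> l) \<noteq> v j)"
          "reg s3 rok = reg s1 rok" "reg s3 rw = reg s1 rw"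
          using 8 s2 regs2 H by (auto simp: same_regs_def same_data_def)
        have data: "same_data s s3" "qtape s3 = qtape s"
          using 7(2) 8(2,3) \<open>same_data _ s2\<close> \<open>qtape s2 = _\<close> by (auto simp: same_data_def I_def)
        note regs3 = I_regs[OF s3(1)]
        have T: "T1 + T2 \<le> k * 32 + 12"
          using \<open>T1 \<le> _\<close> 8(5) by simp
        have s1': "reg s1 rok = of_bool (ok l)" "reg s1 rw = (if dup l then 1 else n * (i + 1))"
          using 7(2) by (auto simp: I_def)
        show ?case
        proof (rule runs_Seq, rule runs_require_unequal, goal_cases)
          case (4 T3 s4)
          have s4: "same_regs ?X s s4" "same_data s s4" "qtape s4 = qtape s" "reg s4 rl = l"
            "reg s4 rd = of_bool (u l \<noteq> u i)" "reg s4 re = of_bool (v (?\<pi> l) \<noteq> v j)"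
            "reg s4 rok = of_bool (ok l \<and> ?\<pi> l \<noteq> j)" "reg s4 rw = reg s1 rw"
            using 4 s3 regs3 data s1' by (auto simp: same_regs_def same_data_def)
          show ?case
          proof (rule runs_Seq, rule runs_require_equal, goal_cases)
            case (4 T4 s5)
            have s5: "same_regs ?X s s5" "same_data s s5" "qtape s5 = qtape s" "reg s5 rl = l"
              "reg s5 rd = of_bool (u l \<noteq> u i)" "reg s5 rok = of_bool (ok (Suc l))"
              "reg s5 rw = reg s1 rw" "reg s5 ri = i"
              using 4 s4 I_regs[OF s4(1)] by (auto simp: same_regs_def same_data_def ok_Suc)
            have "T1 + T2 + T3 + T4 \<le> k * 32 + 22" using T 4(5) \<open>T3 \<le> 5\<close> by simp
            then show ?case
              using s5 s1' by (intro runs_Branch runs_basic) (auto simp: I_def dup_Suc)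
          qed auto
        qed auto
      qed (use regs2 in auto)
    qed (use regs in auto)
  next
    case (8 T s')
    have "dup i \<longleftrightarrow> \<not> fresh u i" by (auto simp: fresh_def dup_def)
    moreover have "i * (k * 32 + 32 + 5) \<le> n * (k * 32 + 40)" using s(2) by (intro mult_le_mono) auto
    then have "T + 4 \<le> n * (k * 32 + 40) + 10" using 8(2) by linarith
    ultimately show ?case
      using 8 by (intro R) (auto simp: I_def compatible_def ok_def mark_def)
  qed (use s ok0 in \<open>auto simp: I_def\<close>)
qed

text \<open>Enlarging the prefix changes only column \<open>i\<close>, whose old multiplicity was 1;
  \<open>attempt\<close> computes \<open>rm'\<close> in this way.\<close>

lemma sum_mark_Suc:
  assumes "i < n"
  shows "(\<Sum>l<n. mark u n (Suc i) l) = (\<Sum>l<n. mark u n i l) + mark u n (Suc i) i - 1"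
proof -
  have "(\<Sum>l\<in>{..<n} - {i}. mark u n (Suc i) l) = (\<Sum>l\<in>{..<n} - {i}. mark u n i l)"
    by (intro sum.cong) (auto simp: mark_def)
  moreover have "mark u n i i = 1" by (simp add: mark_def)
  ultimately show ?thesis
    using assms sum.remove[of "{..<n}" i "mark u n i"] sum.remove[of "{..<n}" i "mark u n (Suc i)"]
    by simp
qed

lemma mark_le: "l < n \<Longrightarrow> mark u n i l \<le> n * n"
  by (auto simp: mark_def intro: mult_le_mono Suc_leI simp flip: mult_Suc_right)

lemma marks_le:
  assumes "marks i \<pi> V" "j < n" "i \<le> n"
  shows "V j \<le> n * n"
proof (cases "j \<in> \<pi> ` {..<i}")
  case True
  then obtain l where "l < i" "j = \<pi> l" by auto
  then show ?thesis using assms mark_le[of l i] by (simp add: marks_def)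
next
  case False
  then show ?thesis using assms by (simp add: marks_def)
qed

lemma marks_cong:
  assumes "\<And>l. l < i \<Longrightarrow> \<pi> l = \<pi>' l" "\<And>j. j < n \<Longrightarrow> V j = V' j" "\<pi> ` {..<i} \<subseteq> {..<n}"
  shows "marks i \<pi> V \<longleftrightarrow> marks i \<pi>' V'"
proof -
  have "\<pi> ` {..<i} = \<pi>' ` {..<i}" using assms(1) by auto
  then show ?thesis using assms by (auto simp: marks_def image_subset_iff)
qed

text \<open>The registers listed are those read by \<open>matched\<close>: \<open>rq\<close> to
  \<open>rV\<close>, and \<open>rm\<close>, which is 30.\<close>

lemma matched_cong:
  assumes "matched i s" "mem s' = mem s" "\<And>x. x \<in> {10..18} \<union> {30} \<Longrightarrow> reg s' x = reg s x"
    "out s' = out s" "qtape s' = qtape s" "\<forall>w\<in>set (asked s'). valid_query w"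
  shows "matched i s'"
proof -
  have "perm_of s' = perm_of s" "marks_of s' = marks_of s"
    using assms(2) by (simp_all add: perm_of_def marks_of_def fun_eq_iff)
  then show ?thesis using assms by (simp add: matched_def ready_def)
qed

lemma matched_set_reg [simp]:
  assumes "x \<notin> {10..18} \<union> {30}"
  shows "matched i (set_reg x a s) \<longleftrightarrow> matched i s"
proof
  have valid: "\<forall>w\<in>set (asked s). valid_query w" if "matched i s" for s
    using that by (simp add: matched_def)
  assume h: "matched i (set_reg x a s)"
  then show "matched i s"
    by (rule matched_cong) (use assms valid[OF h] in auto)
next
  assume h: "matched i s"
  then have "\<forall>w\<in>set (asked s). valid_query w" by (simp add: matched_def)
  with h show "matched i (set_reg x a s)"
    by (intro matched_cong[OF h]) (use assms in auto)
qed

lemma perm_of_set_reg [simp]: "perm_of (set_reg x a s) = perm_of s"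
  by (simp add: perm_of_def fun_eq_iff)

text \<open>Failure has to restore the memory exactly, since the next candidate for the same
  \<open>i\<close> starts from the same invariant.\<close>

lemma runs_attempt:
  assumes s: "matched i s" "i < n" "j < n" "reg s ri = i" "reg s rj = j"
    "reg s rw = mark u n (Suc i) i" "reg s rdone = 0"
    and comp: "compatible i (perm_of s) j"
    and R: "\<And>T s'. same_regs ({0..9} \<union> {rdone, rp, rm, rm'}) s s' \<Longrightarrow>
      length (asked s') = Suc (length (asked s)) \<Longrightarrow>
      (if extendable n C1 C2 (Suc i) ((perm_of s)(i := j))
       then matched (Suc i) s' \<and> reg s' rdone = 1
       else matched i s' \<and> reg s' rdone = 0 \<and> mem s' = mem s) \<Longrightarrow>
      T \<le> 2 * (k * (n * (n * n * 6 + 12) + 10)) + 40 \<Longrightarrow> R T s'"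
  shows "runs Q attempt s R"
proof -
  let ?w = "mark u n (Suc i) i" and ?\<pi> = "perm_of s" and ?m = "\<Sum>l<n. mark u n (Suc i) l"
  define V where "V = (marks_of s)(j := ?w)"
  define M where "M = (mem s)(aW + i := ?w, aV + j := ?w)"
  have regs: "reg s rq = q" "reg s rk = k" "reg s rn = n" "reg s r1 = 1" "reg s rG = 3"
    "reg s rH = 3 + k * n" "reg s rP = aP" "reg s rW = aW" "reg s rV = aV"
    "reg s rm = (\<Sum>l<n. mark u n i l)"
    and data: "out s = []" "qtape s = []" "\<forall>w\<in>set (asked s). valid_query w"
    and ext: "extendable n C1 C2 i ?\<pi>" and mV: "marks i ?\<pi> (marks_of s)"
    and mW: "\<And>l. l < n \<Longrightarrow> mem s (aW + l) = mark u n i l"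
    and cells: "\<And>r l. r < k \<Longrightarrow> l < n \<Longrightarrow>
      mem s (3 + r * n + l) = G ! r ! l \<and> mem s (3 + k * n + r * n + l) = H ! r ! l"
    using s(1) by (auto simp: matched_def ready_def)
  have M_cells: "M (3 + r * n + l) = G ! r ! l" "M (3 + k * n + r * n + l) = H ! r ! l"
    if "r < k" "l < n" for r l
    using cells[OF that] cell_less[OF that] by (auto simp: M_def aW_def aV_def aP_def)
  have M_W: "M (aW + l) = mark u n (Suc i) l" if "l < n" for l
    using mW[OF that] that s(3) by (auto simp: M_def aV_def mark_def)
  have M_V: "M (aV + l) = V l" if "l < n" for l
    using that s(2) by (auto simp: M_def V_def aV_def marks_of_def)
  have V: "marks (Suc i) (?\<pi>(i := j)) V" unfolding V_def by (rule marks_Suc[OF mV comp s(2)])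
  have query: "query (Suc i) V = q # k # ?m #
      concat (map (\<lambda>r. concat (map (\<lambda>l. replicate (M (aW + l)) (M (3 + r * n + l))) [0..<n])) [0..<k]) @
      concat (map (\<lambda>r. concat (map (\<lambda>l.
        replicate (M (aV + l)) (M (3 + k * n + r * n + l))) [0..<n])) [0..<k])"
    unfolding query_def encode_def
    using concat_select_cells[OF rows(1,3), of "\<lambda>l. M (aW + l)" "mark u n (Suc i)"
        "\<lambda>r l. M (3 + r * n + l)"]
      concat_select_cells[OF rows(2,4), of "\<lambda>l. M (aV + l)" V
        "\<lambda>r l. M (3 + k * n + r * n + l)"] M_cells M_W M_V
    by simp
  note answer = query_Suc_correct[OF ext mV comp s(2,3), folded V_def]
  have m: "?m = reg s rm + ?w - 1" using sum_mark_Suc[OF s(2)] regs by simp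
  show ?thesis
    unfolding attempt_def
  proof ((rule runs_Seq, rule runs_basic, (simp add: regs s(4-6) data cong: runs_state_cong)?)+,
      rule runs_Seq, rule runs_put_matrix[where n = n and k = k and w = "n * n"], goal_cases)
    case (6 l)
    then show ?case
      using regs s(4-6) M_W[of l] mark_le[of l "Suc i"] by (simp add: M_def)
  next
    case (7 T1 s1)
    have s1: "same_regs ({0..9} \<union> {rp, rm'}) s s1" "mem s1 = M" "out s1 = []"
      "asked s1 = asked s" "reg s1 9 = aW + i" "reg s1 rp = aV + j" "reg s1 rm' = ?m"
      using 7(1,2) regs data s(4-6) m by (auto simp: same_regs_def same_data_def M_def)
    have q1: "qtape s1 = [q, k, ?m] @ concat (map (\<lambda>r. concat (map (\<lambda>l.
        replicate (M (aW + l)) (M (3 + r * n + l))) [0..<n])) [0..<k])"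
      using 7(3) regs data s(4-6) m by (simp add: M_def)
    have regs1: "reg s1 x = reg s x" if "x \<notin> {0..9} \<union> {rp, rm'}" for x
      using s1(1) that by (rule same_regsD)
    show ?case
    proof (rule runs_Seq, rule runs_put_matrix[where n = n and k = k and w = "n * n"], goal_cases)
      case (6 l)
      then show ?case
        using regs1[of rV] regs M_V[of l] marks_le[OF V, of l] s(2) s1(2) by simp
    next
      case (7 T2 s2)
      have s2: "same_regs ({0..9} \<union> {rp, rm'}) s s2" "mem s2 = M" "out s2 = []"
        "asked s2 = asked s" "reg s2 9 = aW + i" "reg s2 rp = aV + j" "reg s2 rm' = ?m"
        using 7(1,2) s1 by (auto simp: same_regs_def same_data_def)
      have q2: "qtape s2 = query (Suc i) V"
        using 7(3) regs1[of rH] regs1[of rV] regs q1 s1(2) unfolding query by simp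
      have regs2: "reg s2 x = reg s x" if "x \<notin> {0..9} \<union> {rp, rm'}" for x
        using s2(1) that by (rule same_regsD)
      have T: "T1 + T2 \<le> 2 * (k * (n * (n * n * 6 + 12) + 10)) + 10"
        using \<open>T1 \<le> _\<close> 7(4) by simp
      have valid: "\<forall>w\<in>set (asked s @ [query (Suc i) V]). valid_query w"
        using data(3) answer(1) by auto
      let ?yes = "extendable n C1 C2 (Suc i) (?\<pi>(i := j))"
      let ?s3 = "(set_reg 1 (of_bool ?yes) s2)\<lparr>qtape := [], asked := asked s @ [query (Suc i) V]\<rparr>"
      let ?success = "Plus 9 rP ri ;; Store 9 rj ;; Const rdone 1 ;; Const rm 0 ;; Plus rm rm rm'"
      have branches: "runs Q (Branch 1 ?success (Store 9 r1 ;; Store rp r1)) ?s3 R'"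
        if R': "\<And>T s'. same_regs ({0..9} \<union> {rdone, rp, rm, rm'}) s s' \<Longrightarrow>
          length (asked s') = Suc (length (asked s)) \<Longrightarrow>
          (if ?yes then matched (Suc i) s' \<and> reg s' rdone = 1
           else matched i s' \<and> reg s' rdone = 0 \<and> mem s' = mem s) \<Longrightarrow> T \<le> 10 \<Longrightarrow> R' T s'" for R'
      proof (rule runs_Branch, goal_cases)
        case 1
        then have yes: ?yes by (simp split: if_splits)
        show ?case
        proof (intro runs_Seq runs_basic, rule R', goal_cases)
          case 1
          then show ?case using s2(1) by (simp add: same_regs_def)
        next
          case 3
          let ?s = "set_reg rm ?m (set_reg rm 0 (set_reg rdone 1
            ((set_reg 9 (aP + i) ?s3)\<lparr>mem := M(aP + i := j)\<rparr>)))"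
          have perm: "perm_of ?s l = (?\<pi>(i := j)) l" if "l < Suc i" for l
            using that s(2,3) by (auto simp: perm_of_def M_def aW_def aV_def)
          have marks: "marks_of ?s l = V l" if "l < n" for l
            using that s(2) M_V[OF that] by (simp add: marks_of_def aW_def aV_def)
          have img: "perm_of ?s ` {..<Suc i} \<subseteq> {..<n}"
            using extendable_inj(2)[OF yes] s(2) perm by auto
          have "ready ?s"
          proof -
            have "(M(aP + i := j)) (3 + r * n + l) = G ! r ! l"
              "(M(aP + i := j)) (3 + k * n + r * n + l) = H ! r ! l" if "r < k" "l < n" for r l
              using M_cells[OF that] cell_less[OF that] by (auto simp: aP_def)
            then show ?thesis by (simp add: ready_def regs2 regs)
          qed
          moreover have "extendable n C1 C2 (Suc i) (perm_of ?s)"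
            using extendable_cong[of "Suc i" "perm_of ?s" "?\<pi>(i := j)" n C1 C2, OF perm] yes by blast
          moreover have "marks (Suc i) (perm_of ?s) (marks_of ?s)"
            using marks_cong[of "Suc i" "perm_of ?s" "?\<pi>(i := j)" "marks_of ?s" V, OF perm marks img] V
            by blast
          moreover have "\<forall>l<n. mem ?s (aW + l) = mark u n (Suc i) l"
            using M_W s(2) by (simp add: aW_def)
          ultimately have "matched (Suc i) ?s"
            using s2 valid by (simp add: matched_def)
          then show ?case
            using yes regs regs2 s(4,5) s2 by (simp add: fun_upd_def)
        qed simp_all
      next
        case 2
        then have no: "\<not> ?yes" by (simp split: if_splits)
        \<comment> \<open>Column \<open>j\<close> is no partner yet, by \<open>comp\<close>, and
          column \<open>i\<close> is outside the prefix. Both cells held 1, so writing 1 is an exact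
          undo.\<close>
        have "mem s (aV + j) = 1"
        proof -
          have "j \<notin> ?\<pi> ` {..<i}" using comp by (auto simp: compatible_def)
          then show ?thesis using mV s(3) by (simp add: marks_def marks_of_def)
        qed
        moreover have "mem s (aW + i) = 1" using mW[OF s(2)] by (simp add: mark_def)
        ultimately have mem: "M(aW + i := 1, aV + j := 1) = mem s"
          by (auto simp: M_def fun_eq_iff)
        show ?case
        proof (intro runs_Seq runs_basic, rule R', goal_cases)
          case 1
          then show ?case using s2(1) by (simp add: same_regs_def)
        next
          case 3
          have *: "matched i s'" if "mem s' = mem s" "\<And>x. x \<in> {10..18} \<union> {30} \<Longrightarrow> reg s' x = reg s x"
            "out s' = []" "qtape s' = []" "asked s' = asked s @ [query (Suc i) V]" for s'
            using valid data that by (intro matched_cong[OF s(1)]) auto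
          show ?case
            unfolding if_not_P[OF no]
            by (intro conjI *) (use mem regs regs2 s2 s(7) in auto)
        qed simp_all
      qed
      show ?case
      proof (intro runs_Seq runs_Ask, simp only: q2 s2(4) answer(2), rule branches, goal_cases)
        case (1 T s')
        then show ?case using T by (intro R) auto
      qed
    qed (use regs1 regs in auto)
  qed (use regs in simp_all)
qed

lemma matched_n: "matched i s \<Longrightarrow> reg s rn = n"
  by (simp add: matched_def ready_def)

lemma runs_search:
  assumes s: "matched 0 s" "reg s rmark = 0" "asked s = []" and x: "n \<le> x" "k \<le> x"
    and R: "\<And>T s'. matched n s' \<Longrightarrow> length (asked s') \<le> n * n \<Longrightarrow>
      T \<le> x * (x * (attempt_cost x + 5) + 20) + 3 \<Longrightarrow> R T s'"
  shows "runs Q search s R"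
  unfolding search_def
proof (rule runs_For[where N = n and c = "x * (attempt_cost x + 5) + 10"
      and I = "\<lambda>i s'. matched i s' \<and> reg s' rmark = n * i \<and> length (asked s') \<le> i * n"], goal_cases)
  case (7 i s1)
  \<comment> \<open>Either a partner is found or all candidates below \<open>j\<close> are refuted.
    The count \<open>i * n + j\<close> charges each candidate one query, which gives n^2 in the
    end.\<close>
  define J where "J j s \<longleftrightarrow> reg s ri = i \<and> reg s rmark = n * (i + 1) \<and>
    length (asked s) \<le> i * n + j \<and>
    (reg s rdone = 1 \<and> matched (Suc i) s \<or> reg s rdone = 0 \<and> matched i s \<and>
      (\<forall>j'<j. \<not> extendable n C1 C2 (Suc i) ((perm_of s)(i := j'))))" for j s
  have n: "reg s' rn = n" if "J j s'" for j s' using that matched_n by (auto simp: J_def)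
  show ?case
  proof (rule runs_Seq, rule runs_Plus, rule runs_Seq, rule runs_Const,
      rule runs_For[where N = n and I = J and c = "attempt_cost x"], goal_cases)
    case 4
    then show ?case using 7 matched_n by simp
  next
    case 5
    then show ?case using 7 matched_n by (auto simp: J_def)
  next
    case (6 j s y z)
    then show ?case by (simp add: J_def)
  next
    case (7 j s2)
    have i: "i < n" by fact
    have T: "attempt_cost x > 2" by (simp add: attempt_cost_def)
    show ?case
    proof (rule runs_Branch)
      assume "reg s2 rdone \<noteq> 0"
      then have "reg s2 rdone = 1" "matched (Suc i) s2" using 7(2) by (auto simp: J_def)
      then show "runs Q Skip s2 (\<lambda>T s'. Suc T \<le> attempt_cost x \<and> reg s' rj = j \<and> reg s' rn = n \<and>
          J (Suc j) s')"
        using 7 T by (intro runs_Skip) (auto simp: J_def)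
    next
      assume "reg s2 rdone = 0"
      then have s2: "reg s2 rdone = 0" "matched i s2" "reg s2 ri = i" "reg s2 rmark = n * (i + 1)"
        "length (asked s2) \<le> i * n + j"
        "\<And>j'. j' < j \<Longrightarrow> \<not> extendable n C1 C2 (Suc i) ((perm_of s2)(i := j'))"
        using 7(2) by (auto simp: J_def)
      show "runs Q (compare ;; Branch rok attempt Skip) s2
          (\<lambda>T s'. Suc T \<le> attempt_cost x \<and> reg s' rj = j \<and> reg s' rn = n \<and> J (Suc j) s')"
      proof (rule runs_Seq, rule runs_compare[OF s2(2) i 7(1) s2(3) 7(3) s2(4)], goal_cases)
        case (1 T1 s3)
        have regs3: "reg s3 x = reg s2 x" if "x \<notin> {0..9} \<union> {rl, rok, rw, rd, re, rp}" for x
          using 1(1) that by (rule same_regsD)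
        have perm: "perm_of s3 = perm_of s2"
          using 1(2) by (simp add: same_data_def perm_of_def fun_eq_iff)
        have s3: "matched i s3"
          by (rule matched_cong[OF s2(2)]) (use 1 s2(2) regs3 in \<open>auto simp: same_data_def matched_def\<close>)
        have asked3: "asked s3 = asked s2" using 1(2) by (simp add: same_data_def)
        note T_bound = attempt_cost_mono[OF x]
        show ?case
        proof (rule runs_Branch)
          assume "reg s3 rok \<noteq> 0"
          then have comp: "compatible i (perm_of s3) j" using 1(4) perm by (simp split: if_splits)
          show "runs Q attempt s3 (\<lambda>T s'. Suc (T1 + Suc T) \<le> attempt_cost x \<and> reg s' rj = j \<and>
              reg s' rn = n \<and> J (Suc j) s')"
          proof (rule runs_attempt[OF s3 i 7(1) _ _ 1(5) _ comp], goal_cases)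
            case (4 T2 s4)
            have regs4: "reg s4 x = reg s3 x" if "x \<notin> {0..9} \<union> {rdone, rp, rm, rm'}" for x
              using 4(1) that by (rule same_regsD)
            have "\<not> extendable n C1 C2 (Suc i) ((perm_of s4)(i := j'))"
              if "j' < Suc j" "\<not> extendable n C1 C2 (Suc i) ((perm_of s3)(i := j))"
                "mem s4 = mem s3" for j'
            proof -
              have "perm_of s4 = perm_of s2" using that(3) perm by (simp add: perm_of_def fun_eq_iff)
              then show ?thesis using s2(6)[of j'] that(1,2) perm by (auto simp: less_Suc_eq)
            qed
            then have "J (Suc j) s4"
              using 4(2,3) s2 asked3 regs3 regs4 by (auto simp: J_def split: if_splits)
            then show ?case
              using 1(6) 4(4) T_bound regs3 regs4 7(3,4) by auto
          qed (use regs3 s2 7 in auto)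
        next
          assume "reg s3 rok = 0"
          then have "\<not> compatible i (perm_of s2) j" using 1(4) by (simp split: if_splits)
          then have "\<not> extendable n C1 C2 (Suc i) ((perm_of s2)(i := j))"
            using extendable_compatible[OF _ i] by blast
          then have "J (Suc j) s3"
            using s2 s3 asked3 perm regs3 by (auto simp: J_def less_Suc_eq)
          then show "runs Q Skip s3 (\<lambda>T s'. Suc (T1 + Suc T) \<le> attempt_cost x \<and> reg s' rj = j \<and>
              reg s' rn = n \<and> J (Suc j) s')"
            using 1(6) T_bound regs3 7(3,4) by (intro runs_Skip) auto
        qed
      qed
    qed
  next
    case (8 T s2)
    \<comment> \<open>\<open>extendable_Suc\<close> excludes that all \<open>n\<close> candidates
      are refuted, so the inner loop ends with a partner.\<close>
    have "\<not> (reg s2 rdone = 0 \<and> matched i s2 \<and>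
        (\<forall>j'<n. \<not> extendable n C1 C2 (Suc i) ((perm_of s2)(i := j'))))"
      using extendable_Suc[of n C1 C2 i "perm_of s2"] 7(1) by (auto simp: matched_def)
    then have s2: "matched (Suc i) s2" "reg s2 ri = i" "reg s2 rmark = n * Suc i"
      "length (asked s2) \<le> Suc i * n"
      using 8(1) by (auto simp: J_def)
    have "n * (attempt_cost x + 5) \<le> x * (attempt_cost x + 5)" using x by (intro mult_le_mono1)
    then have "T \<le> x * (attempt_cost x + 5) + 3" using 8(2) by linarith
    then show ?case using s2 n[OF 8(1)] by simp
  qed simp_all
next
  case (8 T s')
  have "n * (x * (attempt_cost x + 5) + 10 + 5) \<le> x * (x * (attempt_cost x + 5) + 20)"
    using x by (intro mult_le_mono) auto
  then show ?case using 8 by (intro R) auto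
qed (use s matched_n in auto)

section \<open>Initialisation, output and the complete run\<close>

abbreviation "word \<equiv> encode q k n G H"

lemma runs_setup_regs:
  assumes R: "\<And>T s. ready s \<Longrightarrow> reg s rm = n \<Longrightarrow> reg s rmark = 0 \<Longrightarrow> out s = [] \<Longrightarrow>
    qtape s = [] \<Longrightarrow> asked s = [] \<Longrightarrow> T \<le> k * 12 + 50 \<Longrightarrow> R T s"
  shows "runs Q' setup_regs (init word) R"
proof -
  define M where "M = mem (init word)"
  have M: "M 0 = q" "M (Suc 0) = k" "M 2 = n" by (simp_all add: M_def init_def encode_def)
  have lenG: "length (concat G) = k * n" "length (concat H) = k * n"
    using length_concat_rows[of G n] length_concat_rows[of H n] rows by auto
  have cells: "M (3 + r * n + l) = G ! r ! l" "M (3 + k * n + r * n + l) = H ! r ! l"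
    if "r < k" "l < n" for r l
  proof -
    have less: "r * n + l < k * n" using that by (rule cell_less)
    have "M (3 + m) = (concat G @ concat H) ! m" if "m < k * n + k * n" for m
      using that lenG by (simp add: M_def init_def encode_def eval_nat_numeral)
    from this[of "r * n + l"] this[of "k * n + (r * n + l)"]
    show "M (3 + r * n + l) = G ! r ! l" "M (3 + k * n + r * n + l) = H ! r ! l"
      using less that lenG nth_concat_rows[of G n r l "concat H"] nth_concat_rows[of H n r l "[]"] rows
      by (simp_all add: add.assoc nth_append)
  qed
  have init: "reg (init word) x = 0" "mem (init word) = M" "out (init word) = []"
    "qtape (init word) = []" "asked (init word) = []" for x
    by (simp_all add: init_def M_def)
  show ?thesis
    unfolding setup_regs_def
  proof ((rule runs_Seq, rule runs_basic, (simp add: M init cong: runs_state_cong)?)+,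
      rule runs_Seq, rule runs_add_multiple, goal_cases)
    case (2 T1 s1)
    have s1: "reg s1 rk = k" "reg s1 rn = n" "reg s1 rH = 3 + k * n" "reg s1 rq = q"
      "reg s1 r1 = 1" "reg s1 rG = 3" "reg s1 rmark = 0" "mem s1 = M" "out s1 = []" "qtape s1 = []"
      "asked s1 = []"
      using 2 by (simp_all add: same_regs_def same_data_def init M)
    have T1: "T1 \<le> k * 6 + 3" using 2(5) by (simp add: init M)
    show ?case
    proof ((rule runs_Seq, rule runs_basic, (simp add: s1 cong: runs_state_cong)?)+,
        rule runs_Seq, rule runs_add_multiple, goal_cases)
      case (2 T2 s2)
      have s2: "reg s2 rk = k" "reg s2 rn = n" "reg s2 rH = 3 + k * n" "reg s2 rq = q"
        "reg s2 r1 = 1" "reg s2 rG = 3" "reg s2 rmark = 0" "reg s2 rP = aP" "mem s2 = M"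
        "out s2 = []" "qtape s2 = []" "asked s2 = []"
        using 2 s1 by (simp_all add: same_regs_def same_data_def aP_def)
      have T2: "T2 \<le> k * 6 + 3" using 2(5) s1 by simp
      show ?case
        using s2 T1 T2 cells by (intro runs_Seq runs_basic R) (auto simp: ready_def aW_def aV_def)
    qed simp
  qed simp
qed

lemma runs_setup_mem:
  assumes s: "ready s" "reg s rm = n" "out s = []" "qtape s = []" "asked s = []"
    and equiv: "perm_equivalent n C1 C2"
    and R: "\<And>T s'. matched 0 s' \<Longrightarrow> reg s' rmark = reg s rmark \<Longrightarrow> asked s' = [] \<Longrightarrow>
      T \<le> n * 9 + 3 \<Longrightarrow> R T s'"
  shows "runs Q' setup_mem s R"
  unfolding setup_mem_def
proof (rule runs_For[where N = n and c = 4 and I = "\<lambda>a s'. same_regs {0, 1, 6} s s' \<and>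
      out s' = [] \<and> qtape s' = [] \<and> asked s' = [] \<and>
      (\<forall>l<a. mem s' (aW + l) = 1 \<and> mem s' (aV + l) = 1) \<and> (\<forall>x<aP. mem s' x = mem s x)"],
    goal_cases)
  case (7 a s')
  then have "reg s' r1 = 1" "reg s' rW = aW" "reg s' rV = aV"
    using s(1) by (auto simp: same_regs_def ready_def)
  moreover have "aP \<le> aW" "aW + n = aV" "aW \<le> aV" by (simp_all add: aW_def aV_def)
  ultimately show ?case
    using 7 by (intro runs_Seq runs_basic) (auto simp: less_Suc_eq)
next
  case (8 T s')
  have "mem s' (3 + r * n + l) = G ! r ! l" "mem s' (3 + k * n + r * n + l) = H ! r ! l"
    if "r < k" "l < n" for r l
    using 8(1) s(1) cell_less[OF that] that by (auto simp: ready_def aP_def)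
  moreover have regs: "reg s' x = reg s x" if "x \<notin> {0, 1, 6}" for x
    using 8(1) that by (auto simp: same_regs_def)
  ultimately have "ready s'" using s(1) by (simp add: ready_def)
  \<comment> \<open>The equivalence of the given codes enters here, as extendability of the empty
    prefix.\<close>
  moreover have "extendable n C1 C2 0 (perm_of s')"
    using equiv by (auto simp: extendable_def perm_equivalent_def)
  ultimately have "matched 0 s'"
    using 8(1) regs s(2) by (simp add: matched_def marks_def marks_of_def mark_def)
  then show ?case using 8 regs by (intro R) auto
qed (use s in \<open>auto simp: ready_def\<close>)

lemma runs_write_permutation:
  assumes s: "matched n s"
    and R: "\<And>T s'. out s' = map (perm_of s) [0..<n] \<Longrightarrow> asked s' = asked s \<Longrightarrow> T \<le> n * 8 + 3 \<Longrightarrow> R T s'"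
  shows "runs Q' write_permutation s R"
  unfolding write_permutation_def
proof (rule runs_For[where N = n and c = 3 and I = "\<lambda>a s'. same_regs {0, 1, 2, 6} s s' \<and>
      mem s' = mem s \<and> asked s' = asked s \<and> out s' = map (perm_of s) [0..<a]"], goal_cases)
  case (7 a s')
  then have "reg s' rP = aP" using s by (auto simp: same_regs_def matched_def ready_def)
  then show ?case using 7 by (intro runs_Seq runs_basic) (auto simp: perm_of_def)
next
  case (8 T s')
  then show ?case by (intro R) auto
qed (use s matched_n in \<open>auto simp: matched_def\<close>)

lemma runs_find_permutation:
  assumes equiv: "perm_equivalent n C1 C2" and x: "n \<le> x" "k \<le> x"
  shows "runs Q find_permutation (init word) (\<lambda>T s. T \<le> total_cost x \<and>
    (\<exists>\<pi>. \<pi> permutes {..<n} \<and> act \<pi> ` C1 = C2 \<and> out s = map \<pi> [0..<n]) \<and>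
    length (asked s) \<le> n\<^sup>2 \<and> (\<forall>w\<in>set (asked s). valid_query w))"
  unfolding find_permutation_def
proof (rule runs_Seq, rule runs_setup_regs, goal_cases)
  case (1 T1 s1)
  show ?case
  proof (rule runs_Seq, rule runs_setup_mem[OF 1(1,2,4,5,6) equiv], goal_cases)
    case (1 T2 s2)
    show ?case
    proof (rule runs_Seq, rule runs_search[OF 1(1) _ 1(3) x], goal_cases)
      case 1
      then show ?case using \<open>reg s2 rmark = _\<close> \<open>reg s1 rmark = 0\<close> by simp
    next
      case (2 T3 s3)
      \<comment> \<open>\<open>perm_of s3\<close> reads unrelated cells beyond \<open>n\<close> and
        need not be a permutation; \<open>\<sigma>\<close> agrees with it on the values
        written.\<close>
      obtain \<sigma> where \<sigma>: "\<sigma> permutes {..<n}" "\<forall>l<n. \<sigma> l = perm_of s3 l" "act \<sigma> ` C1 = C2"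
        using 2(1) by (auto simp: matched_def extendable_def)
      have "map (perm_of s3) [0..<n] = map \<sigma> [0..<n]" using \<sigma>(2) by simp
      moreover have "T1 + (T2 + (T3 + T4)) \<le> total_cost x" if "T4 \<le> n * 8 + 3" for T4
      proof -
        \<comment> \<open>The three linear terms add up to the coefficient 29 in
          \<open>total_cost\<close>.\<close>
        have "T1 \<le> x * 12 + 50" "T2 \<le> x * 9 + 3" "T4 \<le> x * 8 + 3"
          using \<open>T1 \<le> _\<close> \<open>T2 \<le> _\<close> that x by linarith+
        then show ?thesis using 2(3) by (simp add: total_cost_def)
      qed
      ultimately show ?case
        using 2 \<sigma> by (intro runs_write_permutation[OF 2(1)])
          (auto simp: matched_def power2_eq_square add.assoc)
    qed
  qed
qed

end

section \<open>From the step count to a polynomial in the input size\<close>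

lemma member_bits_le_input_size: "a \<in> set w \<Longrightarrow> bits a \<le> input_size w"
  unfolding input_size_def by (induction w) auto

lemma length_le_input_size: "length w \<le> input_size w"
  unfolding input_size_def by (induction w) auto

lemma bounded_init: "bounded (input_size w) (init w)"
  using member_bits_le_input_size[of _ w] by (auto simp: bounded_def init_def floorlog_def[of _ 0])

text \<open>\<open>n\<close> and \<open>k\<close> are written in binary, so by themselves they may
  be exponential in the input size. A nonempty matrix, with its \<open>k * n\<close> entries, bounds
  both.\<close>

lemma code_positive:
  assumes "field F" "code F n k d C" "generator_matrix F n k G C"
  shows "0 < n" "0 < k"
proof -
  interpret V: vectorspace F "coord_space F n" by (rule vectorspace_coord_space[OF assms(1)])
  obtain c where c: "c \<in> C" "c \<noteq> \<zero>\<^bsub>coord_space F n\<^esub>"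
    using assms(2) by (auto simp: code_def min_weight_def)
  have "submodule F C (coord_space F n)"
    using assms(2) by (simp add: code_def linear_code_def VectorSpace.subspace_def)
  then have "C \<subseteq> carrier (coord_space F n)" by (rule submodule.subset)
  then have "length c = n" using c(1) by auto
  then show "0 < n" using c(2) by (cases n) auto
  show "0 < k"
  proof (rule ccontr)
    assume "\<not> 0 < k"
    then have "V.span {} = C" using assms(3) by (auto simp: generator_matrix_def)
    then show False using c V.span_empty by auto
  qed
qed

lemma (in pce_pair) find_permutation_correct:
  assumes equiv: "perm_equivalent n C1 C2" and "0 < n" "0 < k"
  defines "N \<equiv> input_size word"
  shows "\<exists>t s \<pi>. exec Q find_permutation (init word) t s \<and>
    t \<le> total_cost N * (3 + 2 * (N + total_cost N)) \<and> \<pi> permutes {..<n} \<and> act \<pi> ` C1 = C2 \<and>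
    out s = map \<pi> [0..<n] \<and> length (asked s) \<le> n\<^sup>2 \<and> (\<forall>w\<in>set (asked s). valid_query w)"
proof -
  have "length (concat G) = k * n" using length_concat_rows[of G n] rows by auto
  \<comment> \<open>The separator charged for each number makes the input size at least the number
    of entries.\<close>
  then have "k * n \<le> N" using length_le_input_size[of word] by (simp add: encode_def N_def)
  moreover have "n \<le> k * n" "k \<le> k * n" using assms(2,3) by auto
  ultimately have "n \<le> N" "k \<le> N" by linarith+
  from runsE[OF runs_find_permutation[OF equiv this]] obtain t s T
    where run: "exec Q find_permutation (init word) t s"
      "T \<le> total_cost N \<and> (\<exists>\<pi>. \<pi> permutes {..<n} \<and> act \<pi> ` C1 = C2 \<and> out s = map \<pi> [0..<n]) \<and>
        length (asked s) \<le> n\<^sup>2 \<and> (\<forall>w\<in>set (asked s). valid_query w)"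
      "\<And>L. bounded L (init word) \<Longrightarrow> bounded (L + T) s \<and> t \<le> T * (3 + 2 * (L + T))"
    by blast
  have "t \<le> T * (3 + 2 * (N + T))" using run(3)[OF bounded_init] by (simp add: N_def)
  also have "\<dots> \<le> total_cost N * (3 + 2 * (N + total_cost N))"
    using run(2) by (intro mult_le_mono add_le_mono) auto
  finally show ?thesis using run(1,2) by blast
qed

theorem theorem1:
  shows "\<exists>(P :: prog) (p :: nat poly).
    \<forall>(F :: nat ring) q Q n k d G H C1 C2.
      field F \<and> carrier F = {..<q} \<and> PCE_oracle F q Q \<and>
      code F n k d C1 \<and> code F n k d C2 \<and>
      generator_matrix F n k G C1 \<and> generator_matrix F n k H C2 \<and>
      perm_equivalent n C1 C2 \<longrightarrow>
      (\<exists>t s \<pi>.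
         exec Q P (init (encode q k n G H)) t s \<and>
         t \<le> poly p (input_size (encode q k n G H)) \<and>
         \<pi> permutes {..<n} \<and> act \<pi> ` C1 = C2 \<and>
         out s = map \<pi> [0..<n] \<and>
         length (asked s) \<le> n\<^sup>2 \<and>
         (\<forall>w \<in> set (asked s). \<exists>m A B D1 D2.
            w = encode q k m A B \<and> PCE_instance F m k A B D1 D2 \<and>
            m \<le> n\<^sup>2 * (n + 1) div 2))"
proof -
  \<comment> \<open>The indeterminate. Evaluating \<open>total_cost X\<close> at \<open>N\<close>
    gives \<open>total_cost N\<close> because evaluation respects sums and products.\<close>
  define X :: "nat poly" where "X = [:0, 1:]"
  define p where "p = total_cost X * (3 + 2 * (X + total_cost X))"
  have "poly X N = N" for N by (simp add: X_def)
  then have p: "poly p N = total_cost N * (3 + 2 * (N + total_cost N))" for N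
    by (simp add: p_def total_cost_def attempt_cost_def)
  show ?thesis
  proof (intro exI[of _ find_permutation] exI[of _ p] allI impI)
    fix F :: "nat ring" and q Q n k d G H C1 C2
    assume *: "field F \<and> carrier F = {..<q} \<and> PCE_oracle F q Q \<and>
      code F n k d C1 \<and> code F n k d C2 \<and>
      generator_matrix F n k G C1 \<and> generator_matrix F n k H C2 \<and> perm_equivalent n C1 C2"
    then have pair: "pce_pair F q n k Q G H C1 C2"
      by (simp only: pce_pair_def code_def)
    have "0 < n" "0 < k" using code_positive[of F n k d C1 G] * by blast+
    then show "\<exists>t s \<pi>. exec Q find_permutation (init (encode q k n G H)) t s \<and>
        t \<le> poly p (input_size (encode q k n G H)) \<and>
        \<pi> permutes {..<n} \<and> act \<pi> ` C1 = C2 \<and> out s = map \<pi> [0..<n] \<and>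
        length (asked s) \<le> n\<^sup>2 \<and>
        (\<forall>w \<in> set (asked s). \<exists>m A B D1 D2. w = encode q k m A B \<and>
          PCE_instance F m k A B D1 D2 \<and> m \<le> n\<^sup>2 * (n + 1) div 2)"
      using pce_pair.find_permutation_correct[OF pair] * p
      unfolding pce_pair.valid_query_def[OF pair] by simp
  qed
qed

end
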